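(* (i) For all $\frac{1}{2}<\beta<\infty$, there exists a constant $C_{\beta}<\infty$, depending only on $\beta$, such that for all $0<a<b<\infty$, with $\Omega=B_b\setminus\overline{B}_a(0)\subset\mathbb{R}^2$, and for all $u\in W^{2,2}_0(\Omega)$, $$\int_{\Omega}\left(\left(\frac{|x|}{b}\right)^{4\beta}+\left(\frac{a}{|x|}\right)^{4\beta}\right)\frac{u^2}{|x|^4}dx\leq C_{\beta}\int_{\Omega}(\Delta u)^2dx.$$ (ii) For all $\sqrt{2}-1<\beta<\infty$, there exists a constant $C_{\beta}'<\infty$, depending only on $\beta$, such that for all $0<a<b<\infty$, with $\Omega=B_b\setminus\overline{B}_a(0)\subset\mathbb{R}^2$, and for all $u\in W^{2,2}_0(\Omega)$, $$\int_{\Omega}\left(\left(\frac{|x|}{b}\right)^{2\beta}+\left(\frac{a}{|x|}\right)^{2\beta}\right)\frac{|\nabla u|^2}{|x|^2}dx\leq C_{\beta}'\int_{\Omega}(\Delta u)^2dx.$$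
   Context: $B_r=B_r(0)$ is the open ball of radius $r$ centred at $0$ in $\mathbb{R}^2$. $W^{2,2}_0(\Omega)$ is the closure of $C^\infty_c(\Omega)$ in $W^{2,2}(\Omega)$. *)

theory Defs
  imports "HOL-Analysis.Analysis"
begin

text \<open>
  A partial derivative of order k is indexed by a list of k coordinate directions rather than by a
  multi-index. Mixed derivatives are hence listed once for every ordering of the directions, which
  only changes the Sobolev norm to an equivalent one.
\<close>

definition pderiv_dir :: "'n \<Rightarrow> (real ^ 'n \<Rightarrow> real) \<Rightarrow> real ^ 'n \<Rightarrow> real" where
  "pderiv_dir i f x = frechet_derivative f (at x) (axis i 1)"

definition pderivs :: "'n list \<Rightarrow> (real ^ 'n \<Rightarrow> real) \<Rightarrow> real ^ 'n \<Rightarrow> real" where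
  "pderivs is f = foldr pderiv_dir is f"

text \<open>
  If all iterated partial derivatives are differentiable everywhere, then they are all continuous,
  so this is the usual class of infinitely differentiable functions.
\<close>

definition smooth :: "(real ^ 'n \<Rightarrow> real) \<Rightarrow> bool" where
  "smooth f \<longleftrightarrow> (\<forall>is x. pderivs is f differentiable (at x))"

definition test_functions :: "(real ^ 'n) set \<Rightarrow> (real ^ 'n \<Rightarrow> real) set" where
  "test_functions \<Omega> =
    {\<phi>. smooth \<phi> \<and> compact (closure {x. \<phi> x \<noteq> 0}) \<and> closure {x. \<phi> x \<noteq> 0} \<subseteq> \<Omega>}"

text \<open>
  Elements of function spaces over \<open>\<Omega>\<close> are represented by total functions. Values outside
  \<open>\<Omega>\<close> and on null sets are irrelevant, and functions are not quotiented by equality almost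
  everywhere.
\<close>

definition locally_integrable_on :: "(real ^ 'n \<Rightarrow> real) \<Rightarrow> (real ^ 'n) set \<Rightarrow> bool" where
  "locally_integrable_on f \<Omega> \<longleftrightarrow>
    (\<forall>K. compact K \<and> K \<subseteq> \<Omega> \<longrightarrow> integrable (lebesgue_on K) f)"

definition L2 :: "(real ^ 'n) set \<Rightarrow> (real ^ 'n \<Rightarrow> real) set" where
  "L2 \<Omega> = {f \<in> borel_measurable (lebesgue_on \<Omega>). integrable (lebesgue_on \<Omega>) (\<lambda>x. (f x)\<^sup>2)}"

definition is_weak_deriv ::
    "(real ^ 'n) set \<Rightarrow> 'n list \<Rightarrow> (real ^ 'n \<Rightarrow> real) \<Rightarrow> (real ^ 'n \<Rightarrow> real) \<Rightarrow> bool" where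
  "is_weak_deriv \<Omega> is u g \<longleftrightarrow>
    locally_integrable_on u \<Omega> \<and> locally_integrable_on g \<Omega> \<and>
    (\<forall>\<phi> \<in> test_functions \<Omega>.
      (LINT x|lebesgue_on \<Omega>. u x * pderivs is \<phi> x) =
      (- 1) ^ length is * (LINT x|lebesgue_on \<Omega>. g x * \<phi> x))"

text \<open>
  On an open set weak derivatives are unique up to a null set, so for a weakly differentiable
  function the choice below is immaterial.
\<close>

definition weak_deriv ::
    "(real ^ 'n) set \<Rightarrow> 'n list \<Rightarrow> (real ^ 'n \<Rightarrow> real) \<Rightarrow> real ^ 'n \<Rightarrow> real" where
  "weak_deriv \<Omega> is u = (SOME g. is_weak_deriv \<Omega> is u g)"

definition weak_gradient ::
    "(real ^ 'n) set \<Rightarrow> (real ^ 'n \<Rightarrow> real) \<Rightarrow> real ^ 'n \<Rightarrow> real ^ 'n" where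
  "weak_gradient \<Omega> u x = (\<chi> i. weak_deriv \<Omega> [i] u x)"

definition weak_laplacian ::
    "(real ^ 'n) set \<Rightarrow> (real ^ 'n \<Rightarrow> real) \<Rightarrow> real ^ 'n \<Rightarrow> real" where
  "weak_laplacian \<Omega> u x = (\<Sum>i\<in>UNIV. weak_deriv \<Omega> [i, i] u x)"

text \<open>\<open>sobolev2 k \<Omega>\<close> is $W^{k,2}(\Omega)$: the order is k and the exponent is 2.\<close>

definition sobolev2 :: "nat \<Rightarrow> (real ^ 'n) set \<Rightarrow> (real ^ 'n \<Rightarrow> real) set" where
  "sobolev2 k \<Omega> =
    {u \<in> L2 \<Omega>. \<forall>is. length is \<le> k \<longrightarrow> (\<exists>g \<in> L2 \<Omega>. is_weak_deriv \<Omega> is u g)}"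

definition sobolev2_norm :: "nat \<Rightarrow> (real ^ 'n) set \<Rightarrow> (real ^ 'n \<Rightarrow> real) \<Rightarrow> real" where
  "sobolev2_norm k \<Omega> u =
    sqrt (\<Sum>is | length is \<le> k. LINT x|lebesgue_on \<Omega>. (weak_deriv \<Omega> is u x)\<^sup>2)"

text \<open>The closure of the test functions in $W^{k,2}(\Omega)$ with respect to its norm.\<close>

definition sobolev2_0 :: "nat \<Rightarrow> (real ^ 'n) set \<Rightarrow> (real ^ 'n \<Rightarrow> real) set" where
  "sobolev2_0 k \<Omega> =
    {u \<in> sobolev2 k \<Omega>. \<forall>\<epsilon>>0. \<exists>\<phi> \<in> test_functions \<Omega>. sobolev2_norm k \<Omega> (\<lambda>x. u x - \<phi> x) < \<epsilon>}"

definition annulus :: "real \<Rightarrow> real \<Rightarrow> (real ^ 2) set" where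
  "annulus a b = ball 0 b - cball 0 a"

end

theory Submission
  imports Defs
begin

text \<open>
  Write r = |x|, t = log r and let \<theta> be the polar angle. With w = u / r the Laplacian becomes
  r \<Delta>u = Lw with Lw = w_tt + 2 w_t + w + w_\<theta>\<theta>, and dx / r^2 = dt d\<theta>. So the integral of (\<Delta>u)^2 dx
  is the integral of (Lw)^2 dt d\<theta>. The angular modes exp(\<plusminus>i\<theta>) are annihilated by w + w_\<theta>\<theta>, so no
  unweighted bound of w by Lw can hold uniformly in the ratio b / a. Three identities give the weighted
  bounds, for compactly supported smooth u and every nonzero exponent \<gamma>.

  (1) Testing Lw with w_t annihilates every term except the first-order one: w_t w_tt and w_t w are
  t-derivatives, and w_t w_\<theta>\<theta> is a \<theta>-derivative minus the t-derivative of (w_\<theta>)^2 / 2. Hence the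
  integrals of w_t Lw and of 2 (w_t)^2 agree, and (w_t)^2 is controlled by (Lw)^2 / 4
  (\<open>pohozaev\<close>, \<open>radial_bound\<close>).

  (2) For E = exp(\<gamma> (t - s)), the t-derivative of E w^2 is E (\<gamma> w^2 + 2 w w_t). So the integral of
  E w^2 is bounded by 4 / \<gamma>^2 times the integral of E (w_t)^2, a Hardy inequality in which \<gamma> may
  have either sign (\<open>hardy_identity\<close>, \<open>weighted_bound\<close>). Wherever E \<le> 1, step (1) applies. The weights
  (|x| / b)^\<gamma> and (a / |x|)^\<gamma> are of this form with exponents \<gamma> and -\<gamma>, and are at most 1 on the
  annulus.

  (3) Testing Lw with E w expresses the integral of E (w_\<theta>)^2 through E w^2, E w w_t, E (w_t)^2 and
  E w Lw, all of which are controlled already (\<open>gradient_identity\<close>, \<open>weighted_gradient_bound\<close>).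

  Part (i) is the case \<gamma> = 4 \<beta> and part (ii) the case \<gamma> = 2 \<beta>.

  In Cartesian coordinates each identity says that an explicit vector field has an explicit
  divergence, and a divergence of compact support integrates to zero. The Sobolev functions follow
  by density (\<open>sobolev2_0_inequality_from_test_functions\<close>): the weights are bounded on a fixed
  annulus, with a bound that multiplies only the approximation error and so does not reach the
  constant. What the density argument needs is that weak derivatives, which are chosen by Hilbert's
  operator, are unique up to null sets (\<open>fundamental_lemma_calculus_of_variations\<close>).
\<close>

section \<open>Derivatives along lines and integration by parts\<close>

text \<open>
  Derivatives along a line suffice for integration by parts and turn differential identities into
  one-variable differentiation rules.
\<close>

definition dir_deriv_on ::
    "'a::euclidean_space set \<Rightarrow> 'a \<Rightarrow> ('a \<Rightarrow> real) \<Rightarrow> ('a \<Rightarrow> real) \<Rightarrow> bool" where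
  "dir_deriv_on U v f g \<longleftrightarrow> (\<forall>x\<in>U. ((\<lambda>t. f (x + t *\<^sub>R v)) has_real_derivative g x) (at 0))"

lemma dir_deriv_onD:
  assumes "dir_deriv_on UNIV v f g"
  shows "((\<lambda>t. f (x + t *\<^sub>R v)) has_real_derivative g (x + s *\<^sub>R v)) (at s)"
proof -
  have "((\<lambda>t. f ((x + s *\<^sub>R v) + t *\<^sub>R v)) has_real_derivative g (x + s *\<^sub>R v)) (at 0)"
    using assms by (auto simp: dir_deriv_on_def)
  then have "((\<lambda>t. f (x + (t + s) *\<^sub>R v)) has_real_derivative g (x + s *\<^sub>R v)) (at 0)"
    by (simp add: algebra_simps)
  then show ?thesis
    using DERIV_shift[of "\<lambda>t. f (x + t *\<^sub>R v)" "g (x + s *\<^sub>R v)" 0 s] by simp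
qed

lemma dir_deriv_on_MVT:
  assumes "dir_deriv_on UNIV v f g" "0 < h"
  obtains s where "0 < s" "s < h" "f (x + h *\<^sub>R v) - f x = h * g (x + s *\<^sub>R v)"
proof -
  have "\<exists>s. 0 < s \<and> s < h \<and> f (x + h *\<^sub>R v) - f (x + 0 *\<^sub>R v) = (h - 0) * g (x + s *\<^sub>R v)"
    using assms dir_deriv_onD by (intro MVT2) auto
  then show thesis using that by auto
qed

lemma continuous_on_extend_by_zero:
  fixes f :: "'a::t2_space \<Rightarrow> 'b::real_normed_vector"
  assumes "compact K" "open U" "K \<subseteq> U" "continuous_on U f" "\<And>x. x \<notin> K \<Longrightarrow> f x = 0"
  shows "continuous_on UNIV f"
proof -
  have "continuous_on (- K) f"
    using assms(5) by (metis ComplD continuous_on_cong continuous_on_const)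
  moreover have "open (- K)" using assms(1) by (simp add: compact_imp_closed open_Compl)
  ultimately have "continuous_on (U \<union> - K) f"
    using assms by (intro continuous_on_open_Un) auto
  moreover have "U \<union> - K = UNIV" using assms(3) by auto
  ultimately show ?thesis by simp
qed

lemma dir_deriv_extend_by_zero:
  assumes "compact K" "K \<subseteq> U" "dir_deriv_on U v f g"
    and f0: "\<And>x. x \<notin> K \<Longrightarrow> f x = 0" and g0: "\<And>x. x \<notin> K \<Longrightarrow> g x = 0"
  shows "dir_deriv_on UNIV v f g"
  unfolding dir_deriv_on_def
proof
  fix x
  show "((\<lambda>t. f (x + t *\<^sub>R v)) has_real_derivative g x) (at 0)"
  proof (cases "x \<in> K")
    case True
    then show ?thesis using assms by (auto simp: dir_deriv_on_def)
  next
    case False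
    have "((\<lambda>t. x + t *\<^sub>R v) \<longlongrightarrow> x + 0 *\<^sub>R v) (nhds 0)"
      by (rule tendsto_add[OF tendsto_const tendsto_scaleR[OF filterlim_ident tendsto_const]])
    moreover have "open (- K)" using assms(1) by (simp add: compact_imp_closed open_Compl)
    ultimately have "\<forall>\<^sub>F t in nhds 0. x + t *\<^sub>R v \<in> - K"
      using False by (intro topological_tendstoD) auto
    then have "\<forall>\<^sub>F t in nhds 0. f (x + t *\<^sub>R v) = 0"
      by eventually_elim (simp add: f0)
    moreover have "((\<lambda>t::real. 0) has_real_derivative 0) (at 0)" by simp
    ultimately show ?thesis using g0[OF False] by (subst DERIV_cong_ev) auto
  qed
qed

lemma integrable_continuous_compact_support:
  fixes f :: "'a::euclidean_space \<Rightarrow> real"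
  assumes "continuous_on UNIV f" "compact K" "\<And>x. x \<notin> K \<Longrightarrow> f x = 0"
  shows "integrable lborel f"
proof -
  have "integrable lborel (\<lambda>x. indicator K x *\<^sub>R f x)"
    using assms borel_integrable_compact continuous_on_subset by blast
  also have "(\<lambda>x. indicator K x *\<^sub>R f x) = f"
    using assms(3) by (intro ext) (metis indicator_simps mult_1 mult_zero_left real_scaleR_def)
  finally show ?thesis .
qed

lemma integral_translate_lborel:
  fixes f :: "'a::euclidean_space \<Rightarrow> real"
  assumes "f \<in> borel_measurable borel"
  shows "(\<integral>x. f (x + c) \<partial>lborel) = (\<integral>x. f x \<partial>lborel)"
proof -
  have "(\<integral>x. f x \<partial>lborel) = (\<integral>x. f x \<partial>distr lborel borel ((+) c))"
    by (simp add: lborel_distr_plus)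
  also have "\<dots> = (\<integral>x. f (c + x) \<partial>lborel)"
    using assms by (subst integral_distr) auto
  finally show ?thesis by (simp add: add.commute)
qed

lemma integrable_translate_lborel:
  fixes f :: "'a::euclidean_space \<Rightarrow> real"
  assumes "integrable lborel f"
  shows "integrable lborel (\<lambda>x. f (x + c))"
proof -
  have "integrable (distr lborel borel ((+) c)) f"
    using assms by (simp add: lborel_distr_plus)
  then have "integrable lborel (\<lambda>x. f (c + x))"
    by (subst (asm) integrable_distr_eq) (use assms in auto)
  then show ?thesis by (simp add: add.commute)
qed

text \<open>
  By translation invariance every difference quotient of \<open>f\<close> has integral zero. The quotients
  converge to \<open>g\<close>, boundedly and with supports in one compact set by the mean value theorem, so
  dominated convergence applies.
\<close>

lemma integral_dir_deriv_eq_0_UNIV: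
  fixes f g :: "'a::euclidean_space \<Rightarrow> real"
  assumes K: "compact K" and f0: "\<And>x. x \<notin> K \<Longrightarrow> f x = 0" and g0: "\<And>x. x \<notin> K \<Longrightarrow> g x = 0"
    and cf: "continuous_on UNIV f" and cg: "continuous_on UNIV g"
    and d: "dir_deriv_on UNIV v f g"
  shows "(\<integral>x. g x \<partial>lborel) = 0"
proof -
  define h where "h = (\<lambda>n. inverse (real (Suc n)))"
  have hpos: "0 < h n" and hle: "h n \<le> 1" for n by (auto simp: h_def field_simps)
  define q where "q = (\<lambda>n x. (f (x + h n *\<^sub>R v) - f x) / h n)"
  have if1: "integrable lborel f" using integrable_continuous_compact_support[OF cf K f0] .
  have q_int: "integrable lborel (q n)" for n
    unfolding q_def using if1 integrable_translate_lborel[OF if1] by auto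
  have q0: "(\<integral>x. q n x \<partial>lborel) = 0" for n
    unfolding q_def using if1 integrable_translate_lborel[OF if1]
    by (simp add: integral_translate_lborel borel_measurable_continuous_onI[OF cf])
  obtain B where B: "\<And>x. \<bar>g x\<bar> \<le> B"
  proof -
    have "compact (g ` K)"
      using cg K compact_continuous_image continuous_on_subset by blast
    then obtain B where "\<forall>y\<in>g ` K. norm y \<le> B" using compact_imp_bounded bounded_iff by metis
    then have "\<bar>g x\<bar> \<le> max B 0" for x using g0[of x] by (cases "x \<in> K") force+
    then show thesis using that by blast
  qed
  \<comment> \<open>All difference quotients with step at most 1 vanish outside this compact set.\<close>
  define K' where "K' = (\<lambda>(x, s). x - s *\<^sub>R v) ` (K \<times> {0..1})"
  have K': "compact K'"
    unfolding K'_def split_def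
    by (rule compact_continuous_image) (auto intro!: continuous_intros compact_Times K)
  have K'I: "x \<in> K'" if "x + s *\<^sub>R v \<in> K" "0 \<le> s" "s \<le> 1" for x s
    unfolding K'_def using that by (intro image_eqI[of _ _ "(x + s *\<^sub>R v, s)"]) auto
  have qb: "norm (q n x) \<le> B * indicator K' x" for n x
  proof (cases "x \<in> K'")
    case True
    obtain s where "f (x + h n *\<^sub>R v) - f x = h n * g (x + s *\<^sub>R v)"
      using dir_deriv_on_MVT[OF d hpos] by metis
    then have "q n x = g (x + s *\<^sub>R v)" unfolding q_def using hpos[of n] by simp
    then show ?thesis using B True by simp
  next
    case False
    then have "x + h n *\<^sub>R v \<notin> K" "x \<notin> K"
      using K'I[of x "h n"] K'I[of x 0] hpos[of n] hle[of n] by auto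
    then show ?thesis using False f0 by (simp add: q_def)
  qed
  have lim: "(\<lambda>n. q n x) \<longlonglongrightarrow> g x" for x
  proof -
    have "(\<lambda>t. (f (x + t *\<^sub>R v) - f x) / t) \<midarrow>0\<rightarrow> g x"
      using d unfolding dir_deriv_on_def DERIV_def by auto
    moreover have "filterlim h (at 0) sequentially"
      unfolding filterlim_at h_def
      using LIMSEQ_inverse_real_of_nat by (auto intro!: always_eventually)
    ultimately show ?thesis unfolding q_def by (rule filterlim_compose)
  qed
  have "(\<lambda>n. \<integral>x. q n x \<partial>lborel) \<longlonglongrightarrow> (\<integral>x. g x \<partial>lborel)"
  proof (rule integral_dominated_convergence)
    show "integrable lborel (\<lambda>x. B * indicator K' x)"
      using emeasure_compact_finite[OF K'] borel_compact[OF K']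
      by (intro integrable_mult_right integrable_real_indicator) simp_all
    show "g \<in> borel_measurable lborel" using borel_measurable_continuous_onI[OF cg] by simp
    show "q n \<in> borel_measurable lborel" for n using q_int by auto
    show "AE x in lborel. (\<lambda>n. q n x) \<longlonglongrightarrow> g x" using lim by simp
    show "AE x in lborel. norm (q n x) \<le> B * indicator K' x" for n using qb by simp
  qed
  then have "(\<lambda>n. 0) \<longlonglongrightarrow> (\<integral>x. g x \<partial>lborel)" using q0 by simp
  then show ?thesis by (simp add: LIMSEQ_const_iff)
qed

lemma integral_dir_deriv_eq_0:
  fixes f g :: "'a::euclidean_space \<Rightarrow> real"
  assumes K: "compact K" "open U" "K \<subseteq> U"
    and f0: "\<And>x. x \<notin> K \<Longrightarrow> f x = 0" and g0: "\<And>x. x \<notin> K \<Longrightarrow> g x = 0"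
    and cf: "continuous_on U f" and cg: "continuous_on U g"
    and d: "dir_deriv_on U v f g"
  shows "integrable lborel g" "(\<integral>x. g x \<partial>lborel) = 0"
proof -
  have cf': "continuous_on UNIV f" by (rule continuous_on_extend_by_zero[OF K cf f0])
  have cg': "continuous_on UNIV g" by (rule continuous_on_extend_by_zero[OF K cg g0])
  show "integrable lborel g" using integrable_continuous_compact_support[OF cg' K(1) g0] .
  show "(\<integral>x. g x \<partial>lborel) = 0"
    using integral_dir_deriv_eq_0_UNIV[OF K(1) f0 g0 cf' cg']
      dir_deriv_extend_by_zero[OF K(1,3) d f0 g0] by blast
qed

lemma second_difference_MVT:
  fixes f :: "'a::euclidean_space \<Rightarrow> real"
  assumes "dir_deriv_on UNIV v f g" "dir_deriv_on UNIV w g k" "0 < h"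
  obtains s t where "0 < s" "s < h" "0 < t" "t < h"
    "f (x + h *\<^sub>R v + h *\<^sub>R w) - f (x + h *\<^sub>R v) - f (x + h *\<^sub>R w) + f x
      = h\<^sup>2 * k (x + s *\<^sub>R v + t *\<^sub>R w)"
proof -
  let ?F = "\<lambda>y. f (y + h *\<^sub>R w) - f y" and ?G = "\<lambda>y. g (y + h *\<^sub>R w) - g y"
  have "dir_deriv_on UNIV v ?F ?G"
    unfolding dir_deriv_on_def
  proof
    fix y
    have "((\<lambda>t. f (y + h *\<^sub>R w + t *\<^sub>R v)) has_real_derivative g (y + h *\<^sub>R w)) (at 0)"
      "((\<lambda>t. f (y + t *\<^sub>R v)) has_real_derivative g y) (at 0)"
      using assms(1) by (auto simp: dir_deriv_on_def)
    from DERIV_diff[OF this]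
    show "((\<lambda>t. ?F (y + t *\<^sub>R v)) has_real_derivative ?G y) (at 0)"
      by (simp add: algebra_simps)
  qed
  from dir_deriv_on_MVT[OF this assms(3), of x] obtain s where
    s: "0 < s" "s < h" "?F (x + h *\<^sub>R v) - ?F x = h * ?G (x + s *\<^sub>R v)" .
  from dir_deriv_on_MVT[OF assms(2,3), of "x + s *\<^sub>R v"] obtain t where
    t: "0 < t" "t < h" "?G (x + s *\<^sub>R v) = h * k (x + s *\<^sub>R v + t *\<^sub>R w)" .
  show thesis using s t by (intro that[of s t]) (auto simp: power2_eq_square algebra_simps)
qed

text \<open>
  Both mixed derivatives are limits of the same second difference quotient, which does not change when the
  two directions are exchanged.
\<close>

lemma mixed_dir_derivs_eq:
  fixes f :: "'a::euclidean_space \<Rightarrow> real"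
  assumes v: "dir_deriv_on UNIV v f g" and vw: "dir_deriv_on UNIV w g k"
    and w: "dir_deriv_on UNIV w f g'" and wv: "dir_deriv_on UNIV v g' k'"
    and "continuous_on UNIV k" "continuous_on UNIV k'"
  shows "k = k'"
proof
  fix x
  define h where "h = (\<lambda>n. inverse (real (Suc n)))"
  have hpos: "0 < h n" for n by (simp add: h_def)
  have h0: "h \<longlonglongrightarrow> 0" unfolding h_def by (rule LIMSEQ_inverse_real_of_nat)
  have "\<exists>s t s' t'. 0 < s \<and> s < h n \<and> 0 < t \<and> t < h n \<and> 0 < s' \<and> s' < h n \<and> 0 < t' \<and> t' < h n \<and>
      k (x + s *\<^sub>R v + t *\<^sub>R w) = k' (x + s' *\<^sub>R w + t' *\<^sub>R v)" for n
  proof -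
    obtain s t where 1: "0 < s" "s < h n" "0 < t" "t < h n"
      "f (x + h n *\<^sub>R v + h n *\<^sub>R w) - f (x + h n *\<^sub>R v) - f (x + h n *\<^sub>R w) + f x
      = (h n)\<^sup>2 * k (x + s *\<^sub>R v + t *\<^sub>R w)"
      using second_difference_MVT[OF v vw hpos, of n x] .
    obtain s' t' where 2: "0 < s'" "s' < h n" "0 < t'" "t' < h n"
      "f (x + h n *\<^sub>R w + h n *\<^sub>R v) - f (x + h n *\<^sub>R w) - f (x + h n *\<^sub>R v) + f x
      = (h n)\<^sup>2 * k' (x + s' *\<^sub>R w + t' *\<^sub>R v)"
      using second_difference_MVT[OF w wv hpos, of n x] .
    have "(h n)\<^sup>2 * k (x + s *\<^sub>R v + t *\<^sub>R w) = (h n)\<^sup>2 * k' (x + s' *\<^sub>R w + t' *\<^sub>R v)"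
      using 1(5) 2(5) by (simp add: algebra_simps)
    then have "k (x + s *\<^sub>R v + t *\<^sub>R w) = k' (x + s' *\<^sub>R w + t' *\<^sub>R v)"
      using hpos[of n] by simp
    with 1 2 show ?thesis by blast
  qed
  then obtain s t s' t' where b: "\<And>n. 0 < s n" "\<And>n. s n < h n" "\<And>n. 0 < t n" "\<And>n. t n < h n"
    "\<And>n. 0 < s' n" "\<And>n. s' n < h n" "\<And>n. 0 < t' n" "\<And>n. t' n < h n"
    and eq: "\<And>n. k (x + s n *\<^sub>R v + t n *\<^sub>R w) = k' (x + s' n *\<^sub>R w + t' n *\<^sub>R v)"
    by metis
  have sq: "p \<longlonglongrightarrow> 0" if "\<And>n. 0 < p n" "\<And>n. p n < h n" for p
    by (rule tendsto_sandwich[OF _ _ tendsto_const h0]) (use that in \<open>auto intro!: always_eventually less_imp_le\<close>)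
  have p1: "(\<lambda>n. x + s n *\<^sub>R v + t n *\<^sub>R w) \<longlonglongrightarrow> x + 0 *\<^sub>R v + 0 *\<^sub>R w"
    by (intro tendsto_intros sq b)
  have p2: "(\<lambda>n. x + s' n *\<^sub>R w + t' n *\<^sub>R v) \<longlonglongrightarrow> x + 0 *\<^sub>R w + 0 *\<^sub>R v"
    by (intro tendsto_intros sq b)
  have "(\<lambda>n. k (x + s n *\<^sub>R v + t n *\<^sub>R w)) \<longlonglongrightarrow> k x"
    using continuous_on_tendsto_compose[OF assms(5) p1] by simp
  moreover have "(\<lambda>n. k' (x + s' n *\<^sub>R w + t' n *\<^sub>R v)) \<longlonglongrightarrow> k' x"
    using continuous_on_tendsto_compose[OF assms(6) p2] by simp
  ultimately show "k x = k' x" unfolding eq by (rule LIMSEQ_unique)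
qed

section \<open>Weighted inequalities in the punctured plane\<close>

definition sqnorm2 :: "real ^ 2 \<Rightarrow> real" where
  "sqnorm2 x = (x$1)\<^sup>2 + (x$2)\<^sup>2"

lemma sqnorm2_pos: "x \<noteq> 0 \<Longrightarrow> 0 < sqnorm2 x"
  unfolding sqnorm2_def
  by (metis (mono_tags, opaque_lifting) exhaust_2 sum_power2_gt_zero_iff vec_eq_iff zero_index)

lemma sqnorm2_eq_norm: "sqnorm2 x = (norm x)\<^sup>2"
  by (simp add: sqnorm2_def norm_vec_def L2_set_def sum_2)

lemma integral_divergence_eq_0:
  fixes F1 F2 G1 G2 :: "real ^ 2 \<Rightarrow> real"
  assumes K: "compact K" "0 \<notin> K"
    and zero: "\<And>x. x \<notin> K \<Longrightarrow> F1 x = 0" "\<And>x. x \<notin> K \<Longrightarrow> G1 x = 0"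
      "\<And>x. x \<notin> K \<Longrightarrow> F2 x = 0" "\<And>x. x \<notin> K \<Longrightarrow> G2 x = 0"
    and cont: "continuous_on (-{0}) F1" "continuous_on (-{0}) G1"
      "continuous_on (-{0}) F2" "continuous_on (-{0}) G2"
    and deriv: "dir_deriv_on (-{0}) (axis 1 1) F1 G1" "dir_deriv_on (-{0}) (axis 2 1) F2 G2"
    and G: "\<And>x. x \<noteq> 0 \<Longrightarrow> G1 x + G2 x = G x" "G 0 = 0"
  shows "integrable lborel G" "(\<integral>x. G x \<partial>lborel) = 0"
proof -
  have sub: "open (-{0::real^2})" "K \<subseteq> -{0}" using K by auto
  have eq: "G = (\<lambda>x. G1 x + G2 x)"
  proof
    fix x show "G x = G1 x + G2 x"
      using G zero(2,4)[OF K(2)] by (cases "x = 0") auto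
  qed
  note i1 = integral_dir_deriv_eq_0[OF K(1) sub zero(1,2) cont(1,2) deriv(1)]
  note i2 = integral_dir_deriv_eq_0[OF K(1) sub zero(3,4) cont(3,4) deriv(2)]
  show "integrable lborel G" "(\<integral>x. G x \<partial>lborel) = 0"
    unfolding eq using i1 i2 by simp_all
qed

text \<open>
  A twice continuously differentiable function of compact support in the punctured plane, given
  together with its partial derivatives. A single name \<open>u12\<close> for both mixed derivatives encodes
  their equality.
\<close>

locale punctured_plane_C2 =
  fixes K :: "(real ^ 2) set" and u u1 u2 u11 u12 u22 :: "real ^ 2 \<Rightarrow> real"
  assumes K: "compact K" "0 \<notin> K"
    and cont: "continuous_on UNIV u" "continuous_on UNIV u1" "continuous_on UNIV u2"
      "continuous_on UNIV u11" "continuous_on UNIV u12" "continuous_on UNIV u22"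
    and zero: "x \<notin> K \<Longrightarrow> u x = 0" "x \<notin> K \<Longrightarrow> u1 x = 0" "x \<notin> K \<Longrightarrow> u2 x = 0"
      "x \<notin> K \<Longrightarrow> u11 x = 0" "x \<notin> K \<Longrightarrow> u12 x = 0" "x \<notin> K \<Longrightarrow> u22 x = 0"
    and deriv: "dir_deriv_on UNIV (axis 1 1) u u1" "dir_deriv_on UNIV (axis 2 1) u u2"
      "dir_deriv_on UNIV (axis 1 1) u1 u11" "dir_deriv_on UNIV (axis 2 1) u1 u12"
      "dir_deriv_on UNIV (axis 1 1) u2 u12" "dir_deriv_on UNIV (axis 2 1) u2 u22"
begin

text \<open>
  In the logarithmic polar variables, \<open>q\<close> is r w_t and \<open>u\<close> is r w. The measure dt d\<theta> is
  \<open>p\<close> dx, so (w_t)^2 dt d\<theta> reads p^2 q^2 dx and w^2 dt d\<theta> reads p^2 u^2 dx. Working with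
  the reciprocal \<open>p\<close> keeps all fields polynomial in \<open>p\<close> and the data.
\<close>

definition p :: "real ^ 2 \<Rightarrow> real" where "p x = 1 / sqnorm2 x"

definition q :: "real ^ 2 \<Rightarrow> real" where "q x = x$1 * u1 x + x$2 * u2 x - u x"

definition lap :: "real ^ 2 \<Rightarrow> real" where "lap x = u11 x + u22 x"

lemma cont': "continuous_on S u" "continuous_on S u1" "continuous_on S u2"
      "continuous_on S u11" "continuous_on S u12" "continuous_on S u22"
  using cont continuous_on_subset by blast+

lemma cont_p: "continuous_on (-{0}) p"
proof -
  have "continuous_on (-{0}) sqnorm2" unfolding sqnorm2_def by (intro continuous_intros)
  then show ?thesis unfolding p_def using sqnorm2_pos
    by (intro continuous_intros) (auto, metis order_less_irrefl)
qed

lemma cont_q: "continuous_on S q"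
  unfolding q_def by (intro continuous_intros cont')

lemma cont_lap: "continuous_on S lap"
  unfolding lap_def by (intro continuous_intros cont')

lemmas conts = cont' cont_p cont_q cont_lap

lemma zero': "x \<notin> K \<Longrightarrow> q x = 0" "x \<notin> K \<Longrightarrow> lap x = 0"
  by (simp_all add: q_def lap_def zero)

lemma derivs:
  "((\<lambda>t. u (x + t *\<^sub>R axis 1 1)) has_real_derivative u1 x) (at 0)"
  "((\<lambda>t. u (x + t *\<^sub>R axis 2 1)) has_real_derivative u2 x) (at 0)"
  "((\<lambda>t. u1 (x + t *\<^sub>R axis 1 1)) has_real_derivative u11 x) (at 0)"
  "((\<lambda>t. u1 (x + t *\<^sub>R axis 2 1)) has_real_derivative u12 x) (at 0)"
  "((\<lambda>t. u2 (x + t *\<^sub>R axis 1 1)) has_real_derivative u12 x) (at 0)"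
  "((\<lambda>t. u2 (x + t *\<^sub>R axis 2 1)) has_real_derivative u22 x) (at 0)"
  using deriv by (auto simp: dir_deriv_on_def)

lemma coord_derivs:
  "((\<lambda>t. (x + t *\<^sub>R axis 1 1) $ 1) has_real_derivative 1) (at 0)"
  "((\<lambda>t. (x + t *\<^sub>R axis 2 1) $ 1) has_real_derivative 0) (at 0)"
  "((\<lambda>t. (x + t *\<^sub>R axis 1 1) $ 2) has_real_derivative 0) (at 0)"
  "((\<lambda>t. (x + t *\<^sub>R axis 2 1) $ 2) has_real_derivative 1) (at 0)"
  for x :: "real ^ 2"
  by (auto simp: axis_def intro!: derivative_eq_intros)

lemma p_derivs:
  assumes "x \<noteq> 0"
  shows "((\<lambda>t. p (x + t *\<^sub>R axis 1 1)) has_real_derivative - 2 * x$1 * (p x)\<^sup>2) (at 0)"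
    "((\<lambda>t. p (x + t *\<^sub>R axis 2 1)) has_real_derivative - 2 * x$2 * (p x)\<^sup>2) (at 0)"
  unfolding p_def sqnorm2_def using sqnorm2_pos[OF assms, unfolded sqnorm2_def]
  by (auto intro!: derivative_eq_intros coord_derivs simp: power2_eq_square axis_def)

lemma p_mult: "x \<noteq> 0 \<Longrightarrow> p x * sqnorm2 x = 1"
  using sqnorm2_pos[of x] unfolding p_def by (simp add: field_simps)

text \<open>
  Testing Lw with w_t. The field \<open>(F1, F2)\<close> is the Cartesian form of
  ((w_t)^2 + w^2 - (w_\<theta>)^2) / 2 in the radial direction plus w_t w_\<theta> in the angular direction. Its
  terms quadratic in the gradient are \<open>p\<close> times the classical Pohozaev field. The
  divergence theorem yields this identity because the two mixed derivatives agree.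
\<close>

lemma pohozaev:
  shows "integrable lborel (\<lambda>x. p x * q x * lap x - 2 * (p x)\<^sup>2 * (q x)\<^sup>2)"
    "(\<integral>x. p x * q x * lap x - 2 * (p x)\<^sup>2 * (q x)\<^sup>2 \<partial>lborel) = 0"
proof -
  define F1 where "F1 = (\<lambda>x. p x * (u1 x * q x - x$1 * ((u1 x)\<^sup>2 + (u2 x)\<^sup>2) / 2) + (p x)\<^sup>2 * (x$1 * (u x)\<^sup>2))"
  define F2 where "F2 = (\<lambda>x. p x * (u2 x * q x - x$2 * ((u1 x)\<^sup>2 + (u2 x)\<^sup>2) / 2) + (p x)\<^sup>2 * (x$2 * (u x)\<^sup>2))"
  define G1 where "G1 = (\<lambda>x. p x * (u11 x * q x + u1 x * (x$1 * u11 x + x$2 * u12 x)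
      - ((u1 x)\<^sup>2 + (u2 x)\<^sup>2) / 2 - x$1 * (u1 x * u11 x + u2 x * u12 x))
      - 2 * x$1 * (p x)\<^sup>2 * (u1 x * q x - x$1 * ((u1 x)\<^sup>2 + (u2 x)\<^sup>2) / 2)
      + (p x)\<^sup>2 * ((u x)\<^sup>2 + 2 * x$1 * u x * u1 x)
      - 4 * x$1 * (p x) ^ 3 * (x$1 * (u x)\<^sup>2))"
  define G2 where "G2 = (\<lambda>x. p x * (u22 x * q x + u2 x * (x$1 * u12 x + x$2 * u22 x)
      - ((u1 x)\<^sup>2 + (u2 x)\<^sup>2) / 2 - x$2 * (u1 x * u12 x + u2 x * u22 x))
      - 2 * x$2 * (p x)\<^sup>2 * (u2 x * q x - x$2 * ((u1 x)\<^sup>2 + (u2 x)\<^sup>2) / 2)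
      + (p x)\<^sup>2 * ((u x)\<^sup>2 + 2 * x$2 * u x * u2 x)
      - 4 * x$2 * (p x) ^ 3 * (x$2 * (u x)\<^sup>2))"
  have z: "F1 x = 0" "F2 x = 0" "G1 x = 0" "G2 x = 0" if "x \<notin> K" for x
    using zero[OF that] zero'[OF that] by (simp_all add: F1_def F2_def G1_def G2_def)
  have c: "continuous_on (-{0}) F1" "continuous_on (-{0}) F2" "continuous_on (-{0}) G1" "continuous_on (-{0}) G2"
    unfolding F1_def F2_def G1_def G2_def by (auto intro!: continuous_intros conts)
  have d1: "dir_deriv_on (-{0}) (axis 1 1) F1 G1"
    unfolding dir_deriv_on_def
  proof
    fix x :: "real ^ 2" assume "x \<in> -{0}"
    then have x: "x \<noteq> 0" by simp
    show "((\<lambda>t. F1 (x + t *\<^sub>R axis 1 1)) has_real_derivative G1 x) (at 0)"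
      unfolding F1_def G1_def q_def
      by (rule derivative_eq_intros derivs coord_derivs p_derivs[OF x] refl | simp; fail)+
        (simp add: axis_def, algebra)
  qed
  have d2: "dir_deriv_on (-{0}) (axis 2 1) F2 G2"
    unfolding dir_deriv_on_def
  proof
    fix x :: "real ^ 2" assume "x \<in> -{0}"
    then have x: "x \<noteq> 0" by simp
    show "((\<lambda>t. F2 (x + t *\<^sub>R axis 2 1)) has_real_derivative G2 x) (at 0)"
      unfolding F2_def G2_def q_def
      by (rule derivative_eq_intros derivs coord_derivs p_derivs[OF x] refl | simp; fail)+
        (simp add: axis_def, algebra)
  qed
  have s: "G1 x + G2 x = p x * q x * lap x - 2 * (p x)\<^sup>2 * (q x)\<^sup>2" if "x \<noteq> 0" for x
  proof -
    \<comment> \<open>The two sides differ by a multiple of \<open>p x * sqnorm2 x - 1\<close>; the cofactor collects the terms of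
      degree 2 and 3 in \<open>p\<close> that carry a factor \<open>sqnorm2 x\<close>.\<close>
    have "G1 x + G2 x - (p x * q x * lap x - 2 * (p x)\<^sup>2 * (q x)\<^sup>2) = (p x * sqnorm2 x - 1) * (p x * ((u1 x)\<^sup>2 + (u2 x)\<^sup>2) - 4 * (p x)\<^sup>2 * (u x)\<^sup>2)"
      unfolding G1_def G2_def lap_def q_def sqnorm2_def
      by (simp add: power2_eq_square power3_eq_cube algebra_simps; algebra)
    then show ?thesis using p_mult[OF that] by simp
  qed
  have "p 0 * q 0 * lap 0 - 2 * (p 0)\<^sup>2 * (q 0)\<^sup>2 = 0" using zero'[OF K(2)] by simp
  note * = integral_divergence_eq_0[of K F1 G1 F2 G2, OF K z(1,3,2,4) c(1,3,2,4) d1 d2 s this]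
  show "integrable lborel (\<lambda>x. p x * q x * lap x - 2 * (p x)\<^sup>2 * (q x)\<^sup>2)"
    "(\<integral>x. p x * q x * lap x - 2 * (p x)\<^sup>2 * (q x)\<^sup>2 \<partial>lborel) = 0" using * by auto
qed

lemma integrable_supported:
  fixes f :: "real ^ 2 \<Rightarrow> real"
  assumes "continuous_on (-{0}) f" "\<And>x. x \<notin> K \<Longrightarrow> f x = 0"
  shows "integrable lborel f"
proof -
  have "continuous_on UNIV f"
    by (rule continuous_on_extend_by_zero[OF K(1) _ _ assms]) (use K(2) in auto)
  from integrable_continuous_compact_support[OF this K(1) assms(2)] show ?thesis by simp
qed

lemma radial_integrable:
  "integrable lborel (\<lambda>x. (lap x)\<^sup>2)"
  "integrable lborel (\<lambda>x. (p x)\<^sup>2 * (q x)\<^sup>2)"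
proof -
  show "integrable lborel (\<lambda>x. (lap x)\<^sup>2)"
    by (rule integrable_supported) (auto intro!: continuous_intros conts simp: zero')
  show "integrable lborel (\<lambda>x. (p x)\<^sup>2 * (q x)\<^sup>2)"
    by (rule integrable_supported) (auto intro!: continuous_intros conts simp: zero')
qed

text \<open>
  Complete the square: the product of w_t and Lw is at most (w_t)^2 + (Lw)^2 / 4.
\<close>

lemma radial_bound:
  "(\<integral>x. (p x)\<^sup>2 * (q x)\<^sup>2 \<partial>lborel) \<le> (1/4) * (\<integral>x. (lap x)\<^sup>2 \<partial>lborel)"
proof -
  have "(\<integral>x. (p x)\<^sup>2 * (q x)\<^sup>2 + (p x * q x * lap x - 2 * (p x)\<^sup>2 * (q x)\<^sup>2) \<partial>lborel)
    \<le> (\<integral>x. (1/4) * (lap x)\<^sup>2 \<partial>lborel)"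
  proof (rule integral_mono)
    fix x
    have "0 \<le> (p x * q x - lap x / 2)\<^sup>2" by simp
    then show "(p x)\<^sup>2 * (q x)\<^sup>2 + (p x * q x * lap x - 2 * (p x)\<^sup>2 * (q x)\<^sup>2) \<le> (1/4) * (lap x)\<^sup>2"
      by (simp add: power2_eq_square algebra_simps)
  qed (intro Bochner_Integration.integrable_add integrable_mult_right radial_integrable pohozaev(1))+
  then show ?thesis
    unfolding Bochner_Integration.integral_add[OF radial_integrable(2) pohozaev(1)] pohozaev(2) by simp
qed

text \<open>
  The weight E is radial and homogeneous of degree \<open>\<gamma>\<close>: its gradient is \<gamma> E x / |x|^2, that is, E_t = \<gamma> E and
  E_\<theta> = 0.
\<close>

context
  fixes E :: "real ^ 2 \<Rightarrow> real" and \<gamma> :: real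
  assumes E_cont: "continuous_on (-{0}) E"
    and E_nonneg: "\<And>x. 0 \<le> E x"
    and E_le_1: "\<And>x. x \<in> K \<Longrightarrow> E x \<le> 1"
    and E_deriv: "dir_deriv_on (-{0}) (axis 1 1) E (\<lambda>x. \<gamma> * E x * x$1 / sqnorm2 x)"
      "dir_deriv_on (-{0}) (axis 2 1) E (\<lambda>x. \<gamma> * E x * x$2 / sqnorm2 x)"
    and \<gamma>: "\<gamma> \<noteq> 0"
begin

lemma E_derivs:
  assumes "x \<noteq> 0"
  shows "((\<lambda>t. E (x + t *\<^sub>R axis 1 1)) has_real_derivative \<gamma> * E x * x$1 * p x) (at 0)"
    "((\<lambda>t. E (x + t *\<^sub>R axis 2 1)) has_real_derivative \<gamma> * E x * x$2 * p x) (at 0)"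
  using E_deriv assms by (auto simp: dir_deriv_on_def p_def)

text \<open>
  The integrand is the t-derivative of \<gamma> E w^2. The factor \<open>\<gamma>\<close> gives w^2 the positive
  coefficient \<gamma>^2 for either sign of \<open>\<gamma>\<close>.
\<close>

lemma hardy_identity:
  shows "integrable lborel (\<lambda>x. E x * (p x)\<^sup>2 * (\<gamma>\<^sup>2 * (u x)\<^sup>2 + 2 * \<gamma> * u x * q x))"
    "(\<integral>x. E x * (p x)\<^sup>2 * (\<gamma>\<^sup>2 * (u x)\<^sup>2 + 2 * \<gamma> * u x * q x) \<partial>lborel) = 0"
proof -
  define F1 where "F1 = (\<lambda>x. \<gamma> * E x * (p x)\<^sup>2 * (x$1 * (u x)\<^sup>2))"
  define F2 where "F2 = (\<lambda>x. \<gamma> * E x * (p x)\<^sup>2 * (x$2 * (u x)\<^sup>2))"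
  define G1 where "G1 = (\<lambda>x. \<gamma> * E x * ((\<gamma> - 4) * x$1 * (p x)^3 * (x$1 * (u x)\<^sup>2)
     + (p x)\<^sup>2 * ((u x)\<^sup>2 + 2 * x$1 * u x * u1 x)))"
  define G2 where "G2 = (\<lambda>x. \<gamma> * E x * ((\<gamma> - 4) * x$2 * (p x)^3 * (x$2 * (u x)\<^sup>2)
     + (p x)\<^sup>2 * ((u x)\<^sup>2 + 2 * x$2 * u x * u2 x)))"
  have z: "F1 x = 0" "F2 x = 0" "G1 x = 0" "G2 x = 0" if "x \<notin> K" for x
    using zero[OF that] zero'[OF that] by (simp_all add: F1_def F2_def G1_def G2_def)
  have c: "continuous_on (-{0}) F1" "continuous_on (-{0}) F2" "continuous_on (-{0}) G1" "continuous_on (-{0}) G2"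
    unfolding F1_def F2_def G1_def G2_def by (auto intro!: continuous_intros conts E_cont)
  have d1: "dir_deriv_on (-{0}) (axis 1 1) F1 G1"
    unfolding dir_deriv_on_def
  proof
    fix x :: "real ^ 2" assume "x \<in> -{0}"
    then have x: "x \<noteq> 0" by simp
    show "((\<lambda>t. F1 (x + t *\<^sub>R axis 1 1)) has_real_derivative G1 x) (at 0)"
      unfolding F1_def G1_def q_def
      by (rule derivative_eq_intros derivs coord_derivs p_derivs[OF x] E_derivs[OF x] refl | simp; fail)+
        (simp add: axis_def, algebra)
  qed
  have d2: "dir_deriv_on (-{0}) (axis 2 1) F2 G2"
    unfolding dir_deriv_on_def
  proof
    fix x :: "real ^ 2" assume "x \<in> -{0}"
    then have x: "x \<noteq> 0" by simp
    show "((\<lambda>t. F2 (x + t *\<^sub>R axis 2 1)) has_real_derivative G2 x) (at 0)"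
      unfolding F2_def G2_def q_def
      by (rule derivative_eq_intros derivs coord_derivs p_derivs[OF x] E_derivs[OF x] refl | simp; fail)+
        (simp add: axis_def, algebra)
  qed
  have s: "G1 x + G2 x = E x * (p x)\<^sup>2 * (\<gamma>\<^sup>2 * (u x)\<^sup>2 + 2 * \<gamma> * u x * q x)" if "x \<noteq> 0" for x
  proof -
    have "G1 x + G2 x - (E x * (p x)\<^sup>2 * (\<gamma>\<^sup>2 * (u x)\<^sup>2 + 2 * \<gamma> * u x * q x)) = (p x * sqnorm2 x - 1) * (\<gamma> * (\<gamma> - 4) * E x * (p x)\<^sup>2 * (u x)\<^sup>2)"
      unfolding G1_def G2_def q_def sqnorm2_def
      by (simp add: power2_eq_square power3_eq_cube algebra_simps)
    then show ?thesis using p_mult[OF that] by simp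
  qed
  have "E 0 * (p 0)\<^sup>2 * (\<gamma>\<^sup>2 * (u 0)\<^sup>2 + 2 * \<gamma> * u 0 * q 0) = 0" using zero(1)[OF K(2)] by simp
  note * = integral_divergence_eq_0[of K F1 G1 F2 G2, OF K z(1,3,2,4) c(1,3,2,4) d1 d2 s this]
  show "integrable lborel (\<lambda>x. E x * (p x)\<^sup>2 * (\<gamma>\<^sup>2 * (u x)\<^sup>2 + 2 * \<gamma> * u x * q x))"
    "(\<integral>x. E x * (p x)\<^sup>2 * (\<gamma>\<^sup>2 * (u x)\<^sup>2 + 2 * \<gamma> * u x * q x) \<partial>lborel) = 0" using * by auto
qed

text \<open>
  Testing Lw with E w. The field combines E w w_t in the radial and E w w_\<theta> in the angular direction;
  there |grad u|^2 / p = (q + u)^2 + r^2 (w_\<theta>)^2 converts (w_\<theta>)^2 into the full gradient.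
\<close>

lemma gradient_identity:
  shows "integrable lborel (\<lambda>x. E x * p x * ((u1 x)\<^sup>2 + (u2 x)\<^sup>2)
      - E x * (p x)\<^sup>2 * (2 * (u x)\<^sup>2 + (4 - \<gamma>) * u x * q x) + E x * p x * u x * lap x)" (is "integrable lborel ?G")
    "(\<integral>x. E x * p x * ((u1 x)\<^sup>2 + (u2 x)\<^sup>2)
      - E x * (p x)\<^sup>2 * (2 * (u x)\<^sup>2 + (4 - \<gamma>) * u x * q x) + E x * p x * u x * lap x \<partial>lborel) = 0"
proof -
  define F1 where "F1 = (\<lambda>x. E x * u x * (p x * u1 x - (p x)\<^sup>2 * (x$1 * u x)))"
  define F2 where "F2 = (\<lambda>x. E x * u x * (p x * u2 x - (p x)\<^sup>2 * (x$2 * u x)))"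
  define G1 where "G1 = (\<lambda>x. E x * (\<gamma> * x$1 * p x * u x + u1 x) * (p x * u1 x - (p x)\<^sup>2 * (x$1 * u x))
    + E x * u x * (p x * u11 x - 2 * x$1 * (p x)\<^sup>2 * u1 x - (p x)\<^sup>2 * (u x + x$1 * u1 x)
      + 4 * x$1 * (p x)^3 * x$1 * u x))"
  define G2 where "G2 = (\<lambda>x. E x * (\<gamma> * x$2 * p x * u x + u2 x) * (p x * u2 x - (p x)\<^sup>2 * (x$2 * u x))
    + E x * u x * (p x * u22 x - 2 * x$2 * (p x)\<^sup>2 * u2 x - (p x)\<^sup>2 * (u x + x$2 * u2 x)
      + 4 * x$2 * (p x)^3 * x$2 * u x))"
  have z: "F1 x = 0" "F2 x = 0" "G1 x = 0" "G2 x = 0" if "x \<notin> K" for x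
    using zero[OF that] zero'[OF that] by (simp_all add: F1_def F2_def G1_def G2_def)
  have c: "continuous_on (-{0}) F1" "continuous_on (-{0}) F2" "continuous_on (-{0}) G1" "continuous_on (-{0}) G2"
    unfolding F1_def F2_def G1_def G2_def by (auto intro!: continuous_intros conts E_cont)
  have d1: "dir_deriv_on (-{0}) (axis 1 1) F1 G1"
    unfolding dir_deriv_on_def
  proof
    fix x :: "real ^ 2" assume "x \<in> -{0}"
    then have x: "x \<noteq> 0" by simp
    show "((\<lambda>t. F1 (x + t *\<^sub>R axis 1 1)) has_real_derivative G1 x) (at 0)"
      unfolding F1_def G1_def q_def
      by (rule derivative_eq_intros derivs coord_derivs p_derivs[OF x] E_derivs[OF x] refl | simp; fail)+
        (simp add: axis_def, algebra)
  qed
  have d2: "dir_deriv_on (-{0}) (axis 2 1) F2 G2"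
    unfolding dir_deriv_on_def
  proof
    fix x :: "real ^ 2" assume "x \<in> -{0}"
    then have x: "x \<noteq> 0" by simp
    show "((\<lambda>t. F2 (x + t *\<^sub>R axis 2 1)) has_real_derivative G2 x) (at 0)"
      unfolding F2_def G2_def q_def
      by (rule derivative_eq_intros derivs coord_derivs p_derivs[OF x] E_derivs[OF x] refl | simp; fail)+
        (simp add: axis_def, algebra)
  qed
  have s: "G1 x + G2 x = ?G x" if "x \<noteq> 0" for x
  proof -
    have "G1 x + G2 x - (?G x) = (p x * sqnorm2 x - 1) * ((4 - \<gamma>) * E x * (p x)\<^sup>2 * (u x)\<^sup>2)"
      unfolding G1_def G2_def lap_def q_def sqnorm2_def
      by (simp add: power2_eq_square power3_eq_cube algebra_simps)
    then show ?thesis using p_mult[OF that] by simp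
  qed
  have "?G 0 = 0" using zero[OF K(2)] by simp
  note * = integral_divergence_eq_0[of K F1 G1 F2 G2 ?G, OF K z(1,3,2,4) c(1,3,2,4) d1 d2 s this]
  show "integrable lborel ?G" "(\<integral>x. ?G x \<partial>lborel) = 0" using * by auto
qed

lemma weighted_integrable:
  "integrable lborel (\<lambda>x. E x * (p x)\<^sup>2 * (u x)\<^sup>2)"
  "integrable lborel (\<lambda>x. E x * p x * ((u1 x)\<^sup>2 + (u2 x)\<^sup>2))"
proof -
  show "integrable lborel (\<lambda>x. E x * (p x)\<^sup>2 * (u x)\<^sup>2)"
    by (rule integrable_supported) (auto intro!: continuous_intros conts E_cont simp: zero)
  show "integrable lborel (\<lambda>x. E x * p x * ((u1 x)\<^sup>2 + (u2 x)\<^sup>2))"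
    by (rule integrable_supported) (auto intro!: continuous_intros conts E_cont simp: zero)
qed

text \<open>
  By \<open>hardy_identity\<close> and the nonnegativity of E (\<gamma> w + 2 w_t)^2 / 2.
\<close>

lemma weighted_bound:
  "(\<integral>x. E x * (p x)\<^sup>2 * (u x)\<^sup>2 \<partial>lborel) \<le> (1 / \<gamma>\<^sup>2) * (\<integral>x. (lap x)\<^sup>2 \<partial>lborel)"
proof -
  let ?X = "\<integral>x. E x * (p x)\<^sup>2 * (u x)\<^sup>2 \<partial>lborel"
  have "(\<integral>x. (\<gamma>\<^sup>2/2) * (E x * (p x)\<^sup>2 * (u x)\<^sup>2) \<partial>lborel)
    \<le> (\<integral>x. E x * (p x)\<^sup>2 * (\<gamma>\<^sup>2 * (u x)\<^sup>2 + 2 * \<gamma> * u x * q x) + 2 * ((p x)\<^sup>2 * (q x)\<^sup>2) \<partial>lborel)"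
  proof (rule integral_mono)
    fix x
    have "0 \<le> E x * (p x)\<^sup>2 * ((\<gamma> * u x + 2 * q x)\<^sup>2 / 2)"
      using E_nonneg by simp
    moreover have "E x * ((p x)\<^sup>2 * (q x)\<^sup>2) \<le> (p x)\<^sup>2 * (q x)\<^sup>2"
      using E_le_1[of x] zero'(1)[of x] by (cases "x \<in> K") (auto simp: E_nonneg mult_left_le_one_le)
    ultimately show "(\<gamma>\<^sup>2/2) * (E x * (p x)\<^sup>2 * (u x)\<^sup>2)
      \<le> E x * (p x)\<^sup>2 * (\<gamma>\<^sup>2 * (u x)\<^sup>2 + 2 * \<gamma> * u x * q x) + 2 * ((p x)\<^sup>2 * (q x)\<^sup>2)"
      by (simp add: power2_eq_square algebra_simps)
  qed (intro Bochner_Integration.integrable_add integrable_mult_right radial_integrable weighted_integrable hardy_identity(1))+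
  then have "(\<gamma>\<^sup>2/2) * ?X \<le> 2 * (\<integral>x. (p x)\<^sup>2 * (q x)\<^sup>2 \<partial>lborel)"
    using hardy_identity radial_integrable weighted_integrable by (simp add: Bochner_Integration.integral_add)
  then have "\<gamma>\<^sup>2 * ?X \<le> (\<integral>x. (lap x)\<^sup>2 \<partial>lborel)" using radial_bound by simp
  then show ?thesis using \<gamma> by (simp add: field_simps)
qed

text \<open>
  Young's inequality splits the cross terms of \<open>gradient_identity\<close>: (4 - \<gamma>) u q costs
  (4 - \<gamma>)^2 / 4 copies of u^2 and one of q^2, and u \<Delta>u / p costs half a copy each of u^2 and
  (\<Delta>u / p)^2. The constant collects these with the factors 1 / \<gamma>^2 and 1/4 of the two earlier bounds.
\<close>

lemma weighted_gradient_bound: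
  "(\<integral>x. E x * p x * ((u1 x)\<^sup>2 + (u2 x)\<^sup>2) \<partial>lborel)
    \<le> ((5/2 + (4 - \<gamma>)\<^sup>2 / 4) / \<gamma>\<^sup>2 + 3/4) * (\<integral>x. (lap x)\<^sup>2 \<partial>lborel)"
proof -
  let ?G = "\<lambda>x. E x * p x * ((u1 x)\<^sup>2 + (u2 x)\<^sup>2)
      - E x * (p x)\<^sup>2 * (2 * (u x)\<^sup>2 + (4 - \<gamma>) * u x * q x) + E x * p x * u x * lap x"
  let ?c = "5/2 + (4 - \<gamma>)\<^sup>2 / 4"
  have "(\<integral>x. E x * p x * ((u1 x)\<^sup>2 + (u2 x)\<^sup>2) \<partial>lborel) \<le>
     (\<integral>x. ?G x + (?c * (E x * (p x)\<^sup>2 * (u x)\<^sup>2) + ((p x)\<^sup>2 * (q x)\<^sup>2 + (1/2) * (lap x)\<^sup>2)) \<partial>lborel)"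
  proof (rule integral_mono)
    fix x
    have "0 \<le> E x * (((4 - \<gamma>) / 2 * (p x * u x) - p x * q x)\<^sup>2 + (p x * u x + lap x)\<^sup>2 / 2)"
      using E_nonneg by simp
    moreover have "E x * ((p x)\<^sup>2 * (q x)\<^sup>2) \<le> (p x)\<^sup>2 * (q x)\<^sup>2"
      "E x * (lap x)\<^sup>2 \<le> (lap x)\<^sup>2"
      using E_le_1[of x] zero'[of x] by (cases "x \<in> K"; auto simp: E_nonneg mult_left_le_one_le)+
    ultimately show "E x * p x * ((u1 x)\<^sup>2 + (u2 x)\<^sup>2) \<le>
      ?G x + (?c * (E x * (p x)\<^sup>2 * (u x)\<^sup>2) + ((p x)\<^sup>2 * (q x)\<^sup>2 + (1/2) * (lap x)\<^sup>2))"
      by (simp add: power2_eq_square field_simps)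
  qed (intro Bochner_Integration.integrable_add integrable_mult_right radial_integrable weighted_integrable gradient_identity(1))+
  also have "\<dots> = ?c * (\<integral>x. E x * (p x)\<^sup>2 * (u x)\<^sup>2 \<partial>lborel)
      + ((\<integral>x. (p x)\<^sup>2 * (q x)\<^sup>2 \<partial>lborel) + (1/2) * (\<integral>x. (lap x)\<^sup>2 \<partial>lborel))"
    using gradient_identity radial_integrable weighted_integrable by (simp add: Bochner_Integration.integral_add)
  also have "\<dots> \<le> ?c * ((1 / \<gamma>\<^sup>2) * (\<integral>x. (lap x)\<^sup>2 \<partial>lborel))
      + ((1/4) * (\<integral>x. (lap x)\<^sup>2 \<partial>lborel) + (1/2) * (\<integral>x. (lap x)\<^sup>2 \<partial>lborel))"
    using weighted_bound radial_bound by (intro add_mono mult_left_mono) auto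
  also have "\<dots> = (?c / \<gamma>\<^sup>2 + 3/4) * (\<integral>x. (lap x)\<^sup>2 \<partial>lborel)"
    by (simp add: algebra_simps add_divide_distrib)
  finally show ?thesis .
qed

end

end

section \<open>Smooth functions and test functions\<close>

lemma pderivs_simps [simp]: "pderivs [] f = f" "pderivs (i # is) f = pderiv_dir i (pderivs is f)"
  by (simp_all add: pderivs_def)

lemma pderivs_append: "pderivs (is @ js) f = pderivs is (pderivs js f)"
  by (simp add: pderivs_def)

lemma smooth_pderivs: "smooth f \<Longrightarrow> smooth (pderivs is f)"
  by (simp add: smooth_def flip: pderivs_append)

lemma smooth_pderiv_dir: "smooth f \<Longrightarrow> smooth (pderiv_dir i f)"
  using smooth_pderivs[of f "[i]"] by simp

lemma smooth_differentiable: "smooth f \<Longrightarrow> f differentiable (at x)"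
  unfolding smooth_def using pderivs_simps(1) by metis

lemma smooth_continuous: "smooth f \<Longrightarrow> continuous_on S f"
  by (meson smooth_differentiable continuous_at_imp_continuous_on differentiable_imp_continuous_within)

lemma pderiv_dir_eq: "(f has_derivative f') (at x) \<Longrightarrow> pderiv_dir i f x = f' (axis i 1)"
  unfolding pderiv_dir_def using frechet_derivative_at by metis

lemma smooth_dir_deriv: "smooth f \<Longrightarrow> dir_deriv_on UNIV (axis i 1) f (pderiv_dir i f)"
  unfolding dir_deriv_on_def
proof
  fix x assume "smooth f"
  define L where "L = frechet_derivative f (at x)"
  have L: "(f has_derivative L) (at x)"
    unfolding L_def using smooth_differentiable[OF \<open>smooth f\<close>] frechet_derivative_works by blast
  have "((\<lambda>t. x + t *\<^sub>R axis i 1) has_derivative (\<lambda>t. t *\<^sub>R axis i 1)) (at 0)"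
    by (auto intro!: derivative_eq_intros)
  from has_derivative_compose[OF this, of f L] L
  have "((\<lambda>t. f (x + t *\<^sub>R axis i 1)) has_derivative (\<lambda>t. L (t *\<^sub>R axis i 1))) (at 0)" by simp
  moreover have "(\<lambda>t. L (t *\<^sub>R axis i 1)) = (*) (pderiv_dir i f x)"
    using linear_scale[OF has_derivative_linear[OF L]] by (auto simp: pderiv_dir_eq[OF L])
  ultimately show "((\<lambda>t. f (x + t *\<^sub>R axis i 1)) has_real_derivative pderiv_dir i f x) (at 0)"
    by (simp add: has_field_derivative_def)
qed

lemma pderiv_dir_commute:
  assumes "smooth f"
  shows "pderiv_dir i (pderiv_dir j f) = pderiv_dir j (pderiv_dir i f)"
  by (rule mixed_dir_derivs_eq[of "axis j 1" f _ "axis i 1"])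
    (use assms in \<open>auto intro: smooth_dir_deriv smooth_pderiv_dir smooth_continuous\<close>)

lemma pderivs_commute:
  assumes "smooth f"
  shows "pderivs is (pderiv_dir i f) = pderiv_dir i (pderivs is f)"
  by (induction "is") (auto simp: pderiv_dir_commute smooth_pderivs assms)

lemma pderivs_eq_0:
  assumes "closed K" "\<And>x. x \<notin> K \<Longrightarrow> f x = 0" "x \<notin> K"
  shows "pderivs is f x = 0"
  using assms(3)
proof (induction "is" arbitrary: x)
  case (Cons i "is")
  have "((\<lambda>x. 0) has_derivative (\<lambda>x. 0)) (at x)" by simp
  then have "(pderivs is f has_derivative (\<lambda>x. 0)) (at x)"
    by (rule has_derivative_transform_within_open[of _ _ _ _ "- K"])
      (use assms(1) Cons in auto)
  then show ?case using pderiv_dir_eq by fastforce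
qed (use assms in auto)

lemma test_functionsE:
  assumes "\<phi> \<in> test_functions \<Omega>"
  obtains K where "compact K" "K \<subseteq> \<Omega>" "smooth \<phi>" "\<And>is x. x \<notin> K \<Longrightarrow> pderivs is \<phi> x = 0"
proof -
  let ?K = "closure {x. \<phi> x \<noteq> 0}"
  have z: "\<phi> x = 0" if "x \<notin> ?K" for x
    using that closure_subset[of "{x. \<phi> x \<noteq> 0}"] by auto
  have "pderivs is \<phi> x = 0" if "x \<notin> ?K" for "is" x
    by (rule pderivs_eq_0[of ?K \<phi>, OF closed_closure z that])
  moreover have "compact ?K" "?K \<subseteq> \<Omega>" "smooth \<phi>" using assms by (auto simp: test_functions_def)
  ultimately show thesis by (intro that[of ?K])
qed

lemma test_functions_pderivs:
  assumes "\<phi> \<in> test_functions \<Omega>"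
  shows "pderivs is \<phi> \<in> test_functions \<Omega>"
proof -
  let ?K = "closure {x. \<phi> x \<noteq> 0}"
  have z: "\<phi> x = 0" if "x \<notin> ?K" for x
    using that closure_subset[of "{x. \<phi> x \<noteq> 0}"] by auto
  have "pderivs is \<phi> x = 0" if "x \<notin> ?K" for x
    by (rule pderivs_eq_0[of ?K \<phi>, OF closed_closure z that])
  then have "{x. pderivs is \<phi> x \<noteq> 0} \<subseteq> ?K" by blast
  then have sub: "closure {x. pderivs is \<phi> x \<noteq> 0} \<subseteq> ?K"
    using closure_minimal closed_closure by blast
  have K: "compact ?K" "?K \<subseteq> \<Omega>" "smooth \<phi>" using assms by (auto simp: test_functions_def)
  have "compact (?K \<inter> closure {x. pderivs is \<phi> x \<noteq> 0})"
    by (rule compact_Int_closed[OF K(1) closed_closure])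
  then have "compact (closure {x. pderivs is \<phi> x \<noteq> 0})"
    using sub by (simp add: inf.absorb2)
  then show ?thesis
    using sub K smooth_pderivs[OF K(3)] by (auto simp: test_functions_def)
qed

lemma lebesgue_on_supported:
  fixes f :: "'a::euclidean_space \<Rightarrow> real"
  assumes "S \<in> sets lebesgue" "T \<in> sets lebesgue" "S \<subseteq> T" "\<And>x. x \<in> T - S \<Longrightarrow> f x = 0"
  shows "integrable (lebesgue_on T) f \<longleftrightarrow> integrable (lebesgue_on S) f"
    "(LINT x|lebesgue_on T. f x) = (LINT x|lebesgue_on S. f x)"
proof -
  have "(\<lambda>x. indicator T x *\<^sub>R f x) = (\<lambda>x. indicator S x *\<^sub>R f x)"
    using assms by (auto simp: indicator_def fun_eq_iff)
  then show "integrable (lebesgue_on T) f \<longleftrightarrow> integrable (lebesgue_on S) f"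
    "(LINT x|lebesgue_on T. f x) = (LINT x|lebesgue_on S. f x)"
    using assms by (simp_all add: integrable_restrict_space integral_restrict_space)
qed

lemma lebesgue_on_lborel_supported:
  fixes f :: "'a::euclidean_space \<Rightarrow> real"
  assumes "continuous_on UNIV f" "compact K" "K \<subseteq> \<Omega>" "open \<Omega>" "\<And>x. x \<notin> K \<Longrightarrow> f x = 0"
  shows "integrable (lebesgue_on \<Omega>) f" "(LINT x|lebesgue_on \<Omega>. f x) = (LINT x|lborel. f x)"
proof -
  have m: "f \<in> borel_measurable lborel" using borel_measurable_continuous_onI[OF assms(1)] by simp
  have *: "integrable (lebesgue_on UNIV) f \<longleftrightarrow> integrable (lebesgue_on \<Omega>) f"
    "(LINT x|lebesgue_on UNIV. f x) = (LINT x|lebesgue_on \<Omega>. f x)"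
    by (rule lebesgue_on_supported; use assms in auto)+
  show "integrable (lebesgue_on \<Omega>) f"
    using * integrable_continuous_compact_support[OF assms(1,2,5)] m
    by (simp add: lebesgue_on_UNIV_eq integrable_completion)
  show "(LINT x|lebesgue_on \<Omega>. f x) = (LINT x|lborel. f x)"
    using * m by (simp add: lebesgue_on_UNIV_eq integral_completion)
qed

lemma test_function_integrable:
  assumes g: "locally_integrable_on g \<Omega>" and "open \<Omega>" and \<phi>: "\<phi> \<in> test_functions \<Omega>"
  shows "integrable (lebesgue_on \<Omega>) (\<lambda>x. g x * \<phi> x)"
proof -
  obtain K where K: "compact K" "K \<subseteq> \<Omega>" "smooth \<phi>" "\<And>is x. x \<notin> K \<Longrightarrow> pderivs is \<phi> x = 0"
    using test_functionsE[OF \<phi>] by blast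
  have z: "\<phi> x = 0" if "x \<notin> K" for x using K(4)[of x "[]"] that by simp
  have Ks: "K \<in> sets lebesgue" using K(1) by (simp add: borel_compact)
  have gi: "integrable (lebesgue_on K) g" using g K by (auto simp: locally_integrable_on_def)
  obtain B where B: "\<And>x. x \<in> K \<Longrightarrow> \<bar>\<phi> x\<bar> \<le> B"
    using compact_imp_bounded[OF compact_continuous_image[OF smooth_continuous[OF K(3)] K(1)]]
    by (auto simp: bounded_iff)
  have m\<phi>: "\<phi> \<in> borel_measurable (lebesgue_on K)"
    using continuous_imp_measurable_on_sets_lebesgue[OF smooth_continuous[OF K(3)] Ks] .
  have "integrable (lebesgue_on K) (\<lambda>x. g x * \<phi> x)"
  proof (rule Bochner_Integration.integrable_bound)
    show "integrable (lebesgue_on K) (\<lambda>x. B * \<bar>g x\<bar>)" using gi by auto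
    show "AE x in lebesgue_on K. norm (g x * \<phi> x) \<le> norm (B * \<bar>g x\<bar>)"
    proof (rule AE_I2)
      fix x assume "x \<in> space (lebesgue_on K)"
      then have "\<bar>\<phi> x\<bar> \<le> \<bar>B\<bar>" using B[of x] by simp
      then show "norm (g x * \<phi> x) \<le> norm (B * \<bar>g x\<bar>)"
        by (simp add: abs_mult mult.commute mult_right_mono)
    qed
  qed (use gi m\<phi> in auto)
  then show ?thesis
    by (subst lebesgue_on_supported(1)[OF Ks]) (use K z \<open>open \<Omega>\<close> in auto)
qed

lemma locally_integrable_test_function:
  assumes "\<phi> \<in> test_functions \<Omega>"
  shows "locally_integrable_on \<phi> \<Omega>"
  unfolding locally_integrable_on_def
proof clarify
  fix K :: "(real^'a) set" assume K: "compact K"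
  have "smooth \<phi>" using assms by (simp add: test_functions_def)
  then have "continuous_on K \<phi>" by (rule smooth_continuous)
  from borel_integrable_compact[OF K this]
  have "integrable lebesgue (\<lambda>x. indicator K x *\<^sub>R \<phi> x)" 
    by (simp add: integrable_completion)
  then show "integrable (lebesgue_on K) \<phi>"
    using K by (simp add: integrable_restrict_space borel_compact)
qed

lemma test_functions_integration_by_parts:
  assumes "open \<Omega>" "\<phi> \<in> test_functions \<Omega>" "\<psi> \<in> test_functions \<Omega>"
  shows "(LINT x|lebesgue_on \<Omega>. \<phi> x * pderiv_dir i \<psi> x) = - (LINT x|lebesgue_on \<Omega>. pderiv_dir i \<phi> x * \<psi> x)"
proof -
  obtain K where K: "compact K" "K \<subseteq> \<Omega>" "smooth \<phi>" "\<And>is x. x \<notin> K \<Longrightarrow> pderivs is \<phi> x = 0"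
    using test_functionsE[OF assms(2)] by blast
  have s: "smooth \<psi>" using assms(3) by (simp add: test_functions_def)
  have z: "\<phi> x = 0" "pderiv_dir i \<phi> x = 0" if "x \<notin> K" for x
    using K(4)[of x "[]"] K(4)[of x "[i]"] that by simp_all
  have c: "continuous_on UNIV (\<lambda>x. \<phi> x * pderiv_dir i \<psi> x)"
    "continuous_on UNIV (\<lambda>x. pderiv_dir i \<phi> x * \<psi> x)"
    "continuous_on UNIV (\<lambda>x. \<phi> x * \<psi> x)"
    using s K(3) by (intro continuous_on_mult smooth_continuous smooth_pderiv_dir; simp)+
  have c4: "continuous_on UNIV (\<lambda>x. pderiv_dir i \<phi> x * \<psi> x + \<phi> x * pderiv_dir i \<psi> x)"
    by (intro continuous_intros c)
  have "dir_deriv_on UNIV (axis i 1) (\<lambda>x. \<phi> x * \<psi> x) (\<lambda>x. pderiv_dir i \<phi> x * \<psi> x + \<phi> x * pderiv_dir i \<psi> x)"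
    using smooth_dir_deriv[OF s, of i] smooth_dir_deriv[OF K(3), of i]
    unfolding dir_deriv_on_def by (auto intro!: derivative_eq_intros)
  then have "(LINT x|lborel. pderiv_dir i \<phi> x * \<psi> x + \<phi> x * pderiv_dir i \<psi> x) = 0"
    by (intro integral_dir_deriv_eq_0_UNIV[OF K(1) _ _ c(3) c4]) (auto simp: z)
  moreover have "(LINT x|lebesgue_on \<Omega>. pderiv_dir i \<phi> x * \<psi> x + \<phi> x * pderiv_dir i \<psi> x)
      = (LINT x|lborel. pderiv_dir i \<phi> x * \<psi> x + \<phi> x * pderiv_dir i \<psi> x)"
    by (rule lebesgue_on_lborel_supported(2)[OF c4 K(1,2) assms(1)]) (simp add: z)
  moreover have "integrable (lebesgue_on \<Omega>) (\<lambda>x. \<phi> x * pderiv_dir i \<psi> x)"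
    "integrable (lebesgue_on \<Omega>) (\<lambda>x. pderiv_dir i \<phi> x * \<psi> x)"
    by (rule lebesgue_on_lborel_supported(1)[OF _ K(1,2) assms(1)]; simp add: z c)+
  ultimately show ?thesis by simp
qed

text \<open>
  Integration by parts moves the outermost derivative of the tested function first, so the derivatives
  reach \<open>\<phi>\<close> in reversed order; \<open>pderivs_commute\<close> restores it.
\<close>

lemma is_weak_deriv_test_function:
  assumes "open \<Omega>" "\<phi> \<in> test_functions \<Omega>"
  shows "is_weak_deriv \<Omega> is \<phi> (pderivs is \<phi>)"
  unfolding is_weak_deriv_def
proof (intro conjI ballI)
  fix \<psi> assume \<psi>: "\<psi> \<in> test_functions \<Omega>"
  show "(LINT x|lebesgue_on \<Omega>. \<phi> x * pderivs is \<psi> x)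
    = (-1) ^ length is * (LINT x|lebesgue_on \<Omega>. pderivs is \<phi> x * \<psi> x)"
    using assms(2)
  proof (induction "is" arbitrary: \<phi>)
    case (Cons i "is")
    have sm: "smooth \<phi>" using Cons.prems by (simp add: test_functions_def)
    have "(LINT x|lebesgue_on \<Omega>. \<phi> x * pderivs (i # is) \<psi> x) =
      - (LINT x|lebesgue_on \<Omega>. pderiv_dir i \<phi> x * pderivs is \<psi> x)"
      using test_functions_integration_by_parts[OF assms(1) Cons.prems test_functions_pderivs[OF \<psi>]]
      by simp
    also have "\<dots> = - ((-1) ^ length is * (LINT x|lebesgue_on \<Omega>. pderivs is (pderiv_dir i \<phi>) x * \<psi> x))"
      using Cons.IH[of "pderiv_dir i \<phi>"] test_functions_pderivs[OF Cons.prems, of "[i]"] by simp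
    finally show ?case using sm by (simp add: pderivs_commute)
  qed simp
qed (use assms in \<open>auto intro!: locally_integrable_test_function test_functions_pderivs\<close>)

section \<open>Bump functions on boxes\<close>

text \<open>
  For \<open>k = 0\<close> this is the classical function exp(-1/t) that is flat at the origin. The negative powers of t make
  the family closed under differentiation up to linear combinations.
\<close>

definition flat :: "nat \<Rightarrow> real \<Rightarrow> real" where
  "flat k t = (if 0 < t then exp (- 1 / t) / t ^ k else 0)"

text \<open>
  A single term of the exponential series dominates any power of 1/t. A quadratic bound is what
  differentiability at the origin needs.
\<close>

lemma flat_le_square:
  assumes "0 < t"
  shows "flat k t \<le> fact (k + 2) * t\<^sup>2"
proof -
  define m where "m = k + 2"
  have "(1 / t) ^ m / fact m = (\<Sum>n\<in>{m}. (1 / t) ^ n /\<^sub>R fact n)"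
    by (simp add: divide_inverse)
  also have "\<dots> \<le> (\<Sum>n. (1 / t) ^ n /\<^sub>R fact n)"
    using assms by (intro sum_le_suminf summable_exp_generic) auto
  also have "\<dots> = exp (1 / t)" by (simp add: exp_def)
  finally have le: "(1 / t) ^ m \<le> fact m * exp (1 / t)" by (simp add: divide_le_eq mult.commute)
  have "exp (- 1 / t) = exp (- 1 / t) * ((1 / t) ^ m * t ^ m)"
    using assms by (simp add: power_divide)
  also have "\<dots> \<le> exp (- 1 / t) * ((fact m * exp (1 / t)) * t ^ m)"
    using assms le by (intro mult_left_mono mult_right_mono) auto
  also have "\<dots> = fact m * t ^ m * (exp (- 1 / t) * exp (1 / t))" by simp
  also have "exp (- 1 / t) * exp (1 / t) = 1" by (simp flip: exp_add)
  finally have "exp (- 1 / t) / t ^ k \<le> fact m * t ^ m / t ^ k"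
    using assms by (intro divide_right_mono) auto
  also have "\<dots> = fact m * t\<^sup>2" using assms by (simp add: m_def power_add power2_eq_square)
  finally show ?thesis using assms by (simp add: flat_def m_def)
qed

lemma flat_bounds: "0 \<le> flat k t" "flat 0 t \<le> 1"
  by (auto simp: flat_def)

lemma flat_deriv: "(flat k has_real_derivative flat (k + 2) t - real k * flat (k + 1) t) (at t)"
proof -
  consider "0 < t" | "t < 0" | "t = 0" by linarith
  then show ?thesis
  proof cases
    case 1
    have "((\<lambda>t. exp (- 1 / t) / t ^ k) has_real_derivative
      (exp (- 1 / t) * (1 / t\<^sup>2) * t ^ k - exp (- 1 / t) * (real k * t ^ (k - 1))) / (t ^ k * t ^ k)) (at t)"
      using 1 by (auto intro!: derivative_eq_intros simp: power2_eq_square)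
    also have "(exp (- 1 / t) * (1 / t\<^sup>2) * t ^ k - exp (- 1 / t) * (real k * t ^ (k - 1))) / (t ^ k * t ^ k)
      = flat (k + 2) t - real k * flat (k + 1) t"
      using 1 by (cases k) (simp_all add: flat_def field_simps power2_eq_square)
    finally have "((\<lambda>t. exp (- 1 / t) / t ^ k) has_real_derivative flat (k + 2) t - real k * flat (k + 1) t) (at t)" .
    then show ?thesis
      by (rule has_field_derivative_transform_within_open[of _ _ _ "{0<..}"]) (use 1 in \<open>auto simp: flat_def\<close>)
  next
    case 2
    have "((\<lambda>t. 0) has_real_derivative flat (k + 2) t - real k * flat (k + 1) t) (at t)"
      using 2 by (simp add: flat_def)
    then show ?thesis
      by (rule has_field_derivative_transform_within_open[of _ _ _ "{..<0}"]) (use 2 in \<open>auto simp: flat_def\<close>)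
  next
    case 3
    have b: "norm (flat k h / h) \<le> fact (k + 2) * \<bar>h\<bar>" for h
    proof (cases "0 < h")
      case True
      then show ?thesis using flat_le_square[OF True, of k] flat_bounds(1)[of k h]
        by (simp add: field_simps power2_eq_square)
    next
      case False
      then have "norm (flat k h / h) = 0" by (simp add: flat_def)
      also have "\<dots> \<le> fact (k + 2) * \<bar>h\<bar>" by (intro mult_nonneg_nonneg) auto
      finally show ?thesis .
    qed
    have "((\<lambda>h. fact (k + 2) * \<bar>h\<bar>) \<longlongrightarrow> fact (k + 2) * \<bar>0\<bar>) (at (0::real))"
      by (intro tendsto_intros)
    then have "((\<lambda>h. fact (k + 2) * \<bar>h\<bar>) \<longlongrightarrow> 0) (at (0::real))" by simp
    then have "((\<lambda>h. flat k h / h) \<longlongrightarrow> 0) (at 0)"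
      by (rule Lim_null_comparison[OF always_eventually[OF allI[OF b]]])
    then show ?thesis using 3 by (simp add: DERIV_def flat_def)
  qed
qed

text \<open>
  A class of differentiable functions that is closed under partial derivatives consists of smooth
  functions. This one is large enough to contain bump functions on boxes.
\<close>

inductive_set flat_algebra :: "(real ^ 'n \<Rightarrow> real) set" where
  const: "(\<lambda>x. c) \<in> flat_algebra"
| flat: "(\<lambda>x. flat k (a * x $ i + b)) \<in> flat_algebra"
| add: "f \<in> flat_algebra \<Longrightarrow> g \<in> flat_algebra \<Longrightarrow> (\<lambda>x. f x + g x) \<in> flat_algebra"
| mult: "f \<in> flat_algebra \<Longrightarrow> g \<in> flat_algebra \<Longrightarrow> (\<lambda>x. f x * g x) \<in> flat_algebra"

lemma flat_algebra_differentiable: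
  fixes f :: "real ^ 'n \<Rightarrow> real"
  shows "f \<in> flat_algebra \<Longrightarrow> (\<forall>x. f differentiable (at x)) \<and> (\<forall>i. pderiv_dir i f \<in> flat_algebra)"
proof (induction rule: flat_algebra.induct)
  case (const c)
  have d: "((\<lambda>x. c) has_derivative (\<lambda>h. 0)) (at x)" for x :: "real ^ 'n" by simp
  have "pderiv_dir i (\<lambda>x. c) = (\<lambda>x. 0)" for i :: 'n using pderiv_dir_eq[OF d] by blast
  then show ?case by (simp add: flat_algebra.const)
next
  case (flat k a i b)
  have d: "((\<lambda>x. flat k (a * x $ i + b)) has_derivative
      (\<lambda>h. (a * h $ i) * (flat (k + 2) (a * x $ i + b) - real k * flat (k + 1) (a * x $ i + b)))) (at x)"
    for x :: "real ^ 'n"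
    by (rule has_derivative_compose[OF _ flat_deriv[unfolded has_field_derivative_def], THEN has_derivative_eq_rhs])
      (auto intro!: derivative_eq_intros bounded_linear_imp_has_derivative bounded_linear_vec_nth)
  have "pderiv_dir j (\<lambda>x. flat k (a * x $ i + b)) =
     (\<lambda>x. (a * axis j 1 $ i) * (flat (k + 2) (a * x $ i + b) + (- real k) * flat (k + 1) (a * x $ i + b)))"
    for j using pderiv_dir_eq[OF d] by fastforce
  moreover have "\<dots> j \<in> flat_algebra" for j
    by (intro flat_algebra.intros)
  ultimately show ?case using d differentiable_def by (metis (mono_tags, lifting))
next
  case (add f g)
  have d: "((\<lambda>x. f x + g x) has_derivative
     (\<lambda>h. frechet_derivative f (at x) h + frechet_derivative g (at x) h)) (at x)" for x
    using add.IH by (intro has_derivative_add) (auto simp: frechet_derivative_works)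
  have "pderiv_dir j (\<lambda>x. f x + g x) = (\<lambda>x. pderiv_dir j f x + pderiv_dir j g x)" for j
    using pderiv_dir_eq[OF d] by (auto simp: pderiv_dir_def)
  then show ?case using add.IH by (auto intro: flat_algebra.add)
next
  case (mult f g)
  have d: "((\<lambda>x. f x * g x) has_derivative
     (\<lambda>h. f x * frechet_derivative g (at x) h + frechet_derivative f (at x) h * g x)) (at x)" for x
    using mult.IH by (intro has_derivative_mult) (auto simp: frechet_derivative_works)
  have "pderiv_dir j (\<lambda>x. f x * g x) = (\<lambda>x. f x * pderiv_dir j g x + pderiv_dir j f x * g x)" for j
    using pderiv_dir_eq[OF d] by (auto simp: pderiv_dir_def)
  moreover have "(\<lambda>x. f x * pderiv_dir j g x + pderiv_dir j f x * g x) \<in> flat_algebra" for j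
    using mult by (intro flat_algebra.add flat_algebra.mult) auto
  ultimately show ?case using mult.IH by auto
qed

lemma flat_algebra_smooth: "f \<in> flat_algebra \<Longrightarrow> smooth f"
proof -
  assume f: "f \<in> flat_algebra"
  have "pderivs is f \<in> flat_algebra" for "is"
    by (induction "is") (use f flat_algebra_differentiable in auto)
  then show ?thesis using flat_algebra_differentiable by (auto simp: smooth_def)
qed

lemma flat_algebra_prod:
  "finite I \<Longrightarrow> (\<And>i. i \<in> I \<Longrightarrow> f i \<in> flat_algebra) \<Longrightarrow> (\<lambda>x. \<Prod>i\<in>I. f i x) \<in> flat_algebra"
  by (induction I rule: finite_induct) (auto intro: flat_algebra.intros)

text \<open>
  Smooth functions that vanish outside the box with corners a and b and increase to its indicator
  function.
\<close>

definition box_bump :: "real ^ 'n \<Rightarrow> real ^ 'n \<Rightarrow> nat \<Rightarrow> real ^ 'n \<Rightarrow> real" where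
  "box_bump a b n x =
    (\<Prod>i\<in>UNIV. flat 0 (real n * (x $ i - a $ i)) * flat 0 (real n * (b $ i - x $ i)))"

lemma box_bump_smooth: "smooth (box_bump a b n)"
proof -
  have "(\<lambda>x. flat 0 (real n * (x $ i - a $ i)) * flat 0 (real n * (b $ i - x $ i))) =
    (\<lambda>x. flat 0 (real n * x $ i + - real n * a $ i) * flat 0 (- real n * x $ i + real n * b $ i))" for i
    by (simp add: algebra_simps)
  moreover have "\<dots> i \<in> flat_algebra" for i by (intro flat_algebra.intros)
  ultimately have "(\<lambda>x. flat 0 (real n * (x $ i - a $ i)) * flat 0 (real n * (b $ i - x $ i))) \<in> flat_algebra" for i
    by simp
  then show ?thesis
    unfolding box_bump_def by (intro flat_algebra_smooth flat_algebra_prod) auto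
qed

lemma box_bump_bounds: "0 \<le> box_bump a b n x" "box_bump a b n x \<le> 1"
  unfolding box_bump_def using flat_bounds
  by (auto intro!: prod_nonneg prod_le_1 mult_le_one mult_nonneg_nonneg)

lemma box_bump_eq_0:
  assumes "x \<notin> box a b"
  shows "box_bump a b n x = 0"
proof -
  obtain i where "x $ i \<le> a $ i \<or> b $ i \<le> x $ i"
    using assms by (auto simp: mem_box_cart not_less)
  then have "flat 0 (real n * (x $ i - a $ i)) * flat 0 (real n * (b $ i - x $ i)) = 0"
    by (auto simp: flat_def zero_less_mult_iff)
  then show ?thesis unfolding box_bump_def by (intro prod_zero) auto
qed

lemma box_bump_test_function: "cbox a b \<subseteq> \<Omega> \<Longrightarrow> box_bump a b n \<in> test_functions \<Omega>"
proof -
  assume ab: "cbox a b \<subseteq> \<Omega>"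
  have "{x. box_bump a b n x \<noteq> 0} \<subseteq> cbox a b"
    using box_bump_eq_0 box_subset_cbox by blast
  then have sub: "closure {x. box_bump a b n x \<noteq> 0} \<subseteq> cbox a b"
    by (rule closure_minimal) (rule closed_cbox)
  then have "compact (closure {x. box_bump a b n x \<noteq> 0})"
    using bounded_subset[OF bounded_cbox] compact_eq_bounded_closed by blast
  then show ?thesis using sub ab box_bump_smooth by (auto simp: test_functions_def)
qed

lemma box_bump_tendsto: "(\<lambda>n. box_bump a b n x) \<longlonglongrightarrow> indicator (box a b) x"
proof (cases "x \<in> box a b")
  case True
  have fl: "(\<lambda>n. flat 0 (real n * c)) \<longlonglongrightarrow> 1" if "0 < c" for c
  proof -
    have "(\<lambda>n. exp (- inverse c * inverse (real n))) \<longlonglongrightarrow> exp (- inverse c * 0)"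
      by (intro tendsto_intros lim_inverse_n)
    moreover have "\<forall>\<^sub>F n in sequentially. exp (- inverse c * inverse (real n)) = flat 0 (real n * c)"
      using eventually_gt_at_top[of 0] by eventually_elim (use that in \<open>simp add: flat_def field_simps\<close>)
    ultimately show ?thesis using tendsto_cong by fastforce
  qed
  have "(\<lambda>n. box_bump a b n x) \<longlonglongrightarrow> (\<Prod>i\<in>(UNIV::'a set). 1 * 1)"
    unfolding box_bump_def using True by (intro tendsto_prod tendsto_mult fl) (auto simp: mem_box_cart)
  then show ?thesis using True by simp
qed (simp add: box_bump_eq_0)

section \<open>Uniqueness of weak derivatives and approximation by test functions\<close>

text \<open>
  Dominated convergence along \<open>box_bump\<close>; the boundary of the box is a null set.
\<close>

lemma integral_cbox_eq_0_of_test_functions: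
  assumes "open \<Omega>" and h: "locally_integrable_on h \<Omega>"
    and zero: "\<And>\<phi>. \<phi> \<in> test_functions \<Omega> \<Longrightarrow> (LINT x|lebesgue_on \<Omega>. h x * \<phi> x) = 0"
    and ab: "cbox a b \<subseteq> \<Omega>"
  shows "h integrable_on cbox a b" "integral (cbox a b) h = 0"
proof -
  have hi: "integrable (lebesgue_on (cbox a b)) h"
    using h ab by (auto simp: locally_integrable_on_def)
  then show hio: "h integrable_on cbox a b" by (rule integrable_on_lebesgue_on) simp
  have eq0: "(LINT x|lebesgue_on (cbox a b). h x * box_bump a b n x) = 0" for n
  proof -
    have "(LINT x|lebesgue_on \<Omega>. h x * box_bump a b n x) = (LINT x|lebesgue_on (cbox a b). h x * box_bump a b n x)"
      using ab \<open>open \<Omega>\<close> box_bump_eq_0 box_subset_cbox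
      by (intro lebesgue_on_supported(2)) fastforce+
    then show ?thesis using zero[OF box_bump_test_function[OF ab]] by simp
  qed
  have m: "box_bump a b n \<in> borel_measurable (lebesgue_on (cbox a b))" for n
    by (intro continuous_imp_measurable_on_sets_lebesgue smooth_continuous box_bump_smooth) simp
  have m2: "(indicator (box a b) :: _ \<Rightarrow> real) \<in> borel_measurable (lebesgue_on (cbox a b))"
    by (rule borel_measurable_LIMSEQ_real[OF _ m]) (rule box_bump_tendsto)
  have "(\<lambda>n. LINT x|lebesgue_on (cbox a b). h x * box_bump a b n x) \<longlonglongrightarrow>
      (LINT x|lebesgue_on (cbox a b). h x * indicator (box a b) x)"
  proof (rule integral_dominated_convergence)
    show "integrable (lebesgue_on (cbox a b)) (\<lambda>x. \<bar>h x\<bar>)" using hi by auto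
    show "AE x in lebesgue_on (cbox a b). (\<lambda>n. h x * box_bump a b n x) \<longlonglongrightarrow> h x * indicator (box a b) x"
      by (intro AE_I2 tendsto_mult tendsto_const box_bump_tendsto)
    show "AE x in lebesgue_on (cbox a b). norm (h x * box_bump a b n x) \<le> \<bar>h x\<bar>" for n
      using box_bump_bounds[of a b n] by (intro AE_I2) (simp add: abs_mult mult_left_le)
  qed (use hi m m2 in auto)
  then have L: "(LINT x|lebesgue_on (cbox a b). h x * indicator (box a b) x) = 0"
    by (simp add: eq0 LIMSEQ_const_iff)
  have "integrable (lebesgue_on (cbox a b)) (\<lambda>x. h x * indicator (box a b) x)"
  proof (rule Bochner_Integration.integrable_bound[OF hi])
    show "(\<lambda>x. h x * indicator (box a b) x) \<in> borel_measurable (lebesgue_on (cbox a b))"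
      using hi m2 by auto
  qed (auto simp: indicator_def)
  from lebesgue_integral_eq_integral[OF this] L
  have "integral (cbox a b) (\<lambda>x. h x * indicator (box a b) x) = 0" by simp
  moreover have "integral (cbox a b) h = integral (cbox a b) (\<lambda>x. h x * indicator (box a b) x)"
    by (rule integral_spike[of "cbox a b - box a b"])
      (auto simp: negligible_frontier_interval indicator_def)
  ultimately show "integral (cbox a b) h = 0" by simp
qed

text \<open>
  By Lebesgue differentiation, almost every value of h is a limit of averages over small cubes.
\<close>

lemma negligible_nonzero_of_zero_integrals:
  fixes h :: "'a::euclidean_space \<Rightarrow> real"
  assumes "h integrable_on cbox a b" and zero: "\<And>c d. cbox c d \<subseteq> cbox a b \<Longrightarrow> integral (cbox c d) h = 0"
  shows "negligible {x \<in> cbox a b. h x \<noteq> 0}"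
proof -
  define F where "F = (\<lambda>x. if x \<in> cbox a b then h x else 0)"
  have "F integrable_on UNIV"
    unfolding F_def using assms(1) integrable_restrict_UNIV by blast
  then have "\<And>c d. F integrable_on cbox c d"
    using integrable_on_subcbox by blast
  then obtain N where N: "negligible N"
    "\<And>x e. \<lbrakk>x \<notin> N; 0 < e\<rbrakk> \<Longrightarrow> \<exists>d>0. \<forall>h. 0 < h \<and> h < d \<longrightarrow>
        norm(integral (cbox x (x + h *\<^sub>R One)) F /\<^sub>R h ^ DIM('a) - F x) < e"
    using integrable_ccontinuous_explicit by metis
  have "h x = 0" if x: "x \<in> box a b" "x \<notin> N" for x
  proof (rule ccontr)
    assume "h x \<noteq> 0"
    then obtain d where d: "d > 0" "\<And>t. 0 < t \<Longrightarrow> t < d \<Longrightarrow>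
        norm (integral (cbox x (x + t *\<^sub>R One)) F /\<^sub>R t ^ DIM('a) - F x) < \<bar>h x\<bar>"
      using N(2)[OF x(2), of "\<bar>h x\<bar>"] by auto
    have "((\<lambda>t. x + t *\<^sub>R One) \<longlongrightarrow> x + 0 *\<^sub>R One) (at_right 0)"
      by (intro tendsto_intros)
    then have "((\<lambda>t. x + t *\<^sub>R One) \<longlongrightarrow> x) (at_right 0)" by simp
    from topological_tendstoD[OF this open_box x(1)]
    have "\<forall>\<^sub>F t in at_right 0. x + t *\<^sub>R One \<in> box a b" .
    moreover have "\<forall>\<^sub>F t in at_right 0. t < d"
      by (rule order_tendstoD(2)[OF tendsto_ident_at d(1)])
    moreover have "\<forall>\<^sub>F t in at_right (0::real). 0 < t" by (simp add: eventually_at_right_less)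
    ultimately have "\<forall>\<^sub>F t in at_right 0. x + t *\<^sub>R One \<in> box a b \<and> t < d \<and> 0 < t"
      by eventually_elim simp
    then obtain t where t: "x + t *\<^sub>R One \<in> box a b" "t < d" "0 < t"
      using eventually_happens' trivial_limit_at_right_real by (metis (no_types, lifting))
    have sub: "cbox x (x + t *\<^sub>R One) \<subseteq> cbox a b"
      using x(1) t(1) by (intro subset_box_imp) (auto simp: mem_box less_imp_le)
    have "integral (cbox x (x + t *\<^sub>R One)) F = integral (cbox x (x + t *\<^sub>R One)) h"
      using sub by (intro integral_cong) (auto simp: F_def)
    also have "\<dots> = 0" using zero[OF sub] .
    finally show False
      using d(2)[OF t(3,2)] x(1) box_subset_cbox[of a b] by (auto simp: F_def)
  qed
  then have "{x \<in> cbox a b. h x \<noteq> 0} \<subseteq> N \<union> (cbox a b - box a b)" by blast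
  moreover have "negligible (N \<union> (cbox a b - box a b))"
    by (intro negligible_Un N(1) negligible_frontier_interval)
  ultimately show ?thesis using negligible_subset by blast
qed

text \<open>
  An open set is a countable union of closed boxes, so it suffices to argue on each box.
\<close>

lemma fundamental_lemma_calculus_of_variations:
  assumes "open \<Omega>" and "locally_integrable_on h \<Omega>"
    and "\<And>\<phi>. \<phi> \<in> test_functions \<Omega> \<Longrightarrow> (LINT x|lebesgue_on \<Omega>. h x * \<phi> x) = 0"
  shows "AE x in lebesgue_on \<Omega>. h x = 0"
proof -
  obtain D where D: "countable D" "D \<subseteq> Pow \<Omega>" "\<And>X. X \<in> D \<Longrightarrow> \<exists>a b. X = cbox a b" "\<Union>D = \<Omega>"
    using open_countable_Union_open_cbox[OF assms(1)] by blast
  have box0: "h integrable_on cbox a b" "integral (cbox a b) h = 0" if "cbox a b \<subseteq> \<Omega>" for a b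
    by (intro integral_cbox_eq_0_of_test_functions[OF assms(1,2) _ that] assms(3); assumption)+
  have neg: "negligible {x \<in> X. h x \<noteq> 0}" if XD: "X \<in> D" for X
  proof -
    obtain a b where X: "X = cbox a b" using D(3)[OF XD] by blast
    have sub: "cbox a b \<subseteq> \<Omega>" using D(2) XD X by blast
    show ?thesis unfolding X
    proof (rule negligible_nonzero_of_zero_integrals)
      show "h integrable_on cbox a b" using box0(1)[OF sub] .
      show "integral (cbox c d) h = 0" if "cbox c d \<subseteq> cbox a b" for c d
        using box0(2) that sub by blast
    qed
  qed
  have "negligible (\<Union>X\<in>D. {x \<in> X. h x \<noteq> 0})"
    using D(1) neg by (intro negligible_countable_Union) auto
  then have "(\<Union>X\<in>D. {x \<in> X. h x \<noteq> 0}) \<in> null_sets lebesgue"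
    by (simp add: negligible_iff_null_sets)
  then have "AE x in lebesgue. x \<in> \<Omega> \<longrightarrow> h x = 0"
    by (rule AE_I') (use D(4) in auto)
  then show ?thesis using assms(1) by (simp add: AE_restrict_space_iff)
qed

lemma locally_integrable_on_diff:
  "locally_integrable_on f \<Omega> \<Longrightarrow> locally_integrable_on g \<Omega> \<Longrightarrow> locally_integrable_on (\<lambda>x. f x - g x) \<Omega>"
  by (auto simp: locally_integrable_on_def)

lemma weak_deriv_unique:
  assumes "open \<Omega>" "is_weak_deriv \<Omega> is u f" "is_weak_deriv \<Omega> is u g"
  shows "AE x in lebesgue_on \<Omega>. f x = g x"
proof -
  have li: "locally_integrable_on f \<Omega>" "locally_integrable_on g \<Omega>"
    using assms by (auto simp: is_weak_deriv_def)
  have "AE x in lebesgue_on \<Omega>. f x - g x = 0"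
  proof (rule fundamental_lemma_calculus_of_variations[OF assms(1)])
    fix \<phi> assume \<phi>: "\<phi> \<in> test_functions \<Omega>"
    have "(LINT x|lebesgue_on \<Omega>. f x * \<phi> x) = (LINT x|lebesgue_on \<Omega>. g x * \<phi> x)"
      using assms(2,3) \<phi> by (auto simp: is_weak_deriv_def)
    then show "(LINT x|lebesgue_on \<Omega>. (f x - g x) * \<phi> x) = 0"
      using test_function_integrable[OF li(1) assms(1) \<phi>] test_function_integrable[OF li(2) assms(1) \<phi>]
      by (simp add: left_diff_distrib)
  qed (use li locally_integrable_on_diff in auto)
  then show ?thesis by simp
qed

lemma is_weak_deriv_diff:
  assumes "open \<Omega>" "is_weak_deriv \<Omega> is u f" "is_weak_deriv \<Omega> is v g"
  shows "is_weak_deriv \<Omega> is (\<lambda>x. u x - v x) (\<lambda>x. f x - g x)"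
  unfolding is_weak_deriv_def
proof (intro conjI ballI)
  have li: "locally_integrable_on f \<Omega>" "locally_integrable_on g \<Omega>"
    "locally_integrable_on u \<Omega>" "locally_integrable_on v \<Omega>"
    using assms by (auto simp: is_weak_deriv_def)
  then show "locally_integrable_on (\<lambda>x. u x - v x) \<Omega>" "locally_integrable_on (\<lambda>x. f x - g x) \<Omega>"
    using locally_integrable_on_diff by auto
  fix \<phi> assume \<phi>: "\<phi> \<in> test_functions \<Omega>"
  note i = test_function_integrable[OF _ assms(1) \<phi>]
    test_function_integrable[OF _ assms(1) test_functions_pderivs[OF \<phi>]]
  show "(LINT x|lebesgue_on \<Omega>. (u x - v x) * pderivs is \<phi> x) =
    (-1) ^ length is * (LINT x|lebesgue_on \<Omega>. (f x - g x) * \<phi> x)"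
    using assms(2,3) \<phi> li i by (simp add: left_diff_distrib right_diff_distrib is_weak_deriv_def)
qed

lemma is_weak_deriv_Nil: "locally_integrable_on u \<Omega> \<Longrightarrow> is_weak_deriv \<Omega> [] u u"
  by (simp add: is_weak_deriv_def)

lemma weak_deriv_AE_eq:
  assumes "open \<Omega>" "is_weak_deriv \<Omega> is u g"
  shows "AE x in lebesgue_on \<Omega>. weak_deriv \<Omega> is u x = g x"
proof -
  have "is_weak_deriv \<Omega> is u (weak_deriv \<Omega> is u)"
    unfolding weak_deriv_def by (rule someI[of _ g]) (rule assms(2))
  then show ?thesis using weak_deriv_unique assms by blast
qed

text \<open>
  Completeness of Lebesgue measure. It transfers measurability from the square integrable weak
  derivative whose existence is assumed to the one that Hilbert's operator selects.
\<close>

lemma borel_measurable_lebesgue_on_AE: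
  fixes f :: "'a::euclidean_space \<Rightarrow> real"
  assumes f: "f \<in> borel_measurable (lebesgue_on S)" "S \<in> sets lebesgue"
    and "AE x in lebesgue_on S. g x = f x"
  shows "g \<in> borel_measurable (lebesgue_on S)"
proof -
  have "(\<lambda>x. indicator S x *\<^sub>R f x) \<in> borel_measurable lebesgue"
    using f by (simp add: borel_measurable_restrict_space_iff)
  moreover have "AE x in lebesgue. indicator S x *\<^sub>R g x = indicator S x *\<^sub>R f x"
    using assms(2,3) by (auto simp: AE_restrict_space_iff indicator_def)
  ultimately have "(\<lambda>x. indicator S x *\<^sub>R g x) \<in> borel_measurable lebesgue"
  proof (intro measurableI)
    fix A :: "real set" assume A: "A \<in> sets borel"
    assume F: "(\<lambda>x. indicator S x *\<^sub>R f x) \<in> borel_measurable lebesgue"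
      and ae: "AE x in lebesgue. indicator S x *\<^sub>R g x = indicator S x *\<^sub>R f x"
    show "(\<lambda>x. indicator S x *\<^sub>R g x) -` A \<inter> space lebesgue \<in> sets lebesgue"
      by (rule completion.in_sets_AE[OF _ measurable_sets[OF F A]]) (use ae in auto)
  qed auto
  then show ?thesis using f(2) by (simp add: borel_measurable_restrict_space_iff)
qed

lemma L2_diff:
  assumes "f \<in> L2 \<Omega>" "g \<in> L2 \<Omega>"
  shows "(\<lambda>x. f x - g x) \<in> L2 \<Omega>"
proof -
  have "integrable (lebesgue_on \<Omega>) (\<lambda>x. (f x - g x)\<^sup>2)"
  proof (rule Bochner_Integration.integrable_bound)
    show "integrable (lebesgue_on \<Omega>) (\<lambda>x. 2 * (f x)\<^sup>2 + 2 * (g x)\<^sup>2)"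
      using assms by (auto simp: L2_def)
    have "(f x - g x)\<^sup>2 \<le> 2 * (f x)\<^sup>2 + 2 * (g x)\<^sup>2" for x
      using zero_le_power2[of "f x + g x"] by (simp add: power2_eq_square algebra_simps)
    then show "AE x in lebesgue_on \<Omega>. norm ((f x - g x)\<^sup>2) \<le> norm (2 * (f x)\<^sup>2 + 2 * (g x)\<^sup>2)"
      by simp
  qed (use assms in \<open>auto simp: L2_def\<close>)
  then show ?thesis using assms by (auto simp: L2_def)
qed

lemma test_functions_L2:
  assumes "open \<Omega>" "\<phi> \<in> test_functions \<Omega>"
  shows "\<phi> \<in> L2 \<Omega>"
proof -
  obtain K where K: "compact K" "K \<subseteq> \<Omega>" "smooth \<phi>" "\<And>is x. x \<notin> K \<Longrightarrow> pderivs is \<phi> x = 0"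
    using test_functionsE[OF assms(2)] by blast
  have z: "\<phi> x = 0" if "x \<notin> K" for x using K(4)[of x "[]"] that by simp
  have c: "continuous_on S \<phi>" for S by (rule smooth_continuous[OF K(3)])
  have "integrable (lebesgue_on \<Omega>) (\<lambda>x. (\<phi> x)\<^sup>2)"
    by (rule lebesgue_on_lborel_supported(1)[OF _ K(1,2) assms(1)])
      (auto intro!: continuous_intros c simp: z)
  moreover have "\<phi> \<in> borel_measurable (lebesgue_on \<Omega>)"
    using continuous_imp_measurable_on_sets_lebesgue[OF c] assms(1) by simp
  ultimately show ?thesis by (simp add: L2_def)
qed

text \<open>
  The Sobolev norm of \<open>u - \<phi>\<close> is built from chosen weak derivatives of the difference, and a
  Bochner integral is 0 when its integrand is not integrable. Uniqueness of weak derivatives shows that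
  the chosen ones are square integrable and agree with differences of derivatives, so a small norm does
  mean a good approximation.
\<close>

lemma sobolev2_0_approximation:
  fixes u :: "real ^ 'n \<Rightarrow> real"
  assumes "open \<Omega>" and u: "u \<in> sobolev2_0 k \<Omega>" and "0 < \<epsilon>"
  obtains \<phi> where "\<phi> \<in> test_functions \<Omega>"
    "\<And>is g. length is \<le> k \<Longrightarrow> is_weak_deriv \<Omega> is u g \<Longrightarrow>
      (\<integral>\<^sup>+x. ennreal ((g x - pderivs is \<phi> x)\<^sup>2) \<partial>lebesgue_on \<Omega>) \<le> ennreal \<epsilon>"
proof -
  have "\<forall>\<delta>>0. \<exists>\<phi>\<in>test_functions \<Omega>. sobolev2_norm k \<Omega> (\<lambda>x. u x - \<phi> x) < \<delta>"
    using u by (simp add: sobolev2_0_def)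
  moreover have "0 < sqrt \<epsilon>" using \<open>0 < \<epsilon>\<close> by simp
  ultimately obtain \<phi> where \<phi>: "\<phi> \<in> test_functions \<Omega>"
    and n: "sobolev2_norm k \<Omega> (\<lambda>x. u x - \<phi> x) < sqrt \<epsilon>"
    by metis
  let ?I = "\<lambda>is. LINT x|lebesgue_on \<Omega>. (weak_deriv \<Omega> is (\<lambda>x. u x - \<phi> x) x)\<^sup>2"
  have fin: "finite {is :: 'n list. length is \<le> k}"
    using finite_lists_length_le[of "UNIV :: 'n set" k] by simp
  have sum: "(\<Sum>is | length is \<le> k. ?I is) < \<epsilon>"
    using n by (simp add: sobolev2_norm_def)
  have "(\<integral>\<^sup>+x. ennreal ((g x - pderivs is \<phi> x)\<^sup>2) \<partial>lebesgue_on \<Omega>) \<le> ennreal \<epsilon>"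
    if len: "length is \<le> k" and g: "is_weak_deriv \<Omega> is u g" for "is" g
  proof -
    have "u \<in> sobolev2 k \<Omega>" using u by (simp add: sobolev2_0_def)
    then obtain f where f: "f \<in> L2 \<Omega>" "is_weak_deriv \<Omega> is u f"
      using len by (auto simp: sobolev2_def)
    let ?f = "\<lambda>x. f x - pderivs is \<phi> x"
    have fL2: "?f \<in> L2 \<Omega>"
      by (intro L2_diff f test_functions_L2 assms test_functions_pderivs \<phi>)
    have wf: "AE x in lebesgue_on \<Omega>. weak_deriv \<Omega> is (\<lambda>x. u x - \<phi> x) x = ?f x"
      by (intro weak_deriv_AE_eq is_weak_deriv_diff is_weak_deriv_test_function assms f \<phi>)
    have m: "weak_deriv \<Omega> is (\<lambda>x. u x - \<phi> x) \<in> borel_measurable (lebesgue_on \<Omega>)"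
      by (rule borel_measurable_lebesgue_on_AE[OF _ _ wf]) (use fL2 assms(1) in \<open>auto simp: L2_def\<close>)
    have "AE x in lebesgue_on \<Omega>. g x = f x"
      using weak_deriv_unique[OF assms(1) g f(2)] .
    then have "(\<integral>\<^sup>+x. ennreal ((g x - pderivs is \<phi> x)\<^sup>2) \<partial>lebesgue_on \<Omega>)
      = (\<integral>\<^sup>+x. ennreal ((?f x)\<^sup>2) \<partial>lebesgue_on \<Omega>)"
      by (intro nn_integral_cong_AE) auto
    also have "\<dots> = ennreal (LINT x|lebesgue_on \<Omega>. (?f x)\<^sup>2)"
      using fL2 by (intro nn_integral_eq_integral) (auto simp: L2_def)
    also have "(LINT x|lebesgue_on \<Omega>. (?f x)\<^sup>2) = ?I is"
      by (rule integral_cong_AE) (use fL2 m wf in \<open>auto simp: L2_def\<close>)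
    finally have "(\<integral>\<^sup>+x. ennreal ((g x - pderivs is \<phi> x)\<^sup>2) \<partial>lebesgue_on \<Omega>) = ennreal (?I is)" .
    moreover have "?I is \<le> (\<Sum>is | length is \<le> k. ?I is)"
      using len by (intro member_le_sum[OF _ _ fin]) auto
    ultimately have "(\<integral>\<^sup>+x. ennreal ((g x - pderivs is \<phi> x)\<^sup>2) \<partial>lebesgue_on \<Omega>)
      \<le> ennreal (\<Sum>is | length is \<le> k. ?I is)" by (simp add: ennreal_leI)
    also have "\<dots> \<le> ennreal \<epsilon>" using sum by (intro ennreal_leI less_imp_le)
    finally show ?thesis .
  qed
  then show thesis by (rule that[OF \<phi>])
qed

lemma weak_deriv_measurable:
  assumes "open \<Omega>" "u \<in> sobolev2 k \<Omega>" "length is \<le> k" "is_weak_deriv \<Omega> is u g"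
  shows "g \<in> borel_measurable (lebesgue_on \<Omega>)"
proof -
  obtain f where f: "f \<in> L2 \<Omega>" "is_weak_deriv \<Omega> is u f"
    using assms by (auto simp: sobolev2_def)
  then show ?thesis
    using borel_measurable_lebesgue_on_AE[of f \<Omega> g] weak_deriv_unique[OF assms(1,4) f(2)] assms(1)
    by (auto simp: L2_def)
qed

lemma ennreal_linear_combination:
  assumes "0 \<le> p" "0 \<le> q" "0 \<le> \<alpha>" "0 \<le> \<beta>"
  shows "ennreal \<alpha> * ennreal p + ennreal \<beta> * ennreal q = ennreal (\<alpha> * p + \<beta> * q)"
  using assms by (simp flip: ennreal_mult ennreal_plus)

text \<open>
  Two applications of (s + t)^2 \<le> 2 s^2 + 2 t^2, one on either side of the inequality for test functions, give
  the factor 4. The errors are multiples of the squared approximation distance \<open>\<delta>\<close>, with a factor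
  \<open>Q\<close> that depends on the bound M of the weight but not on \<open>\<delta>\<close>.
\<close>

lemma sobolev2_0_inequality_from_test_functions:
  fixes u :: "real ^ 'n \<Rightarrow> real" and C M :: real
  assumes \<Omega>: "open \<Omega>" and u: "u \<in> sobolev2_0 k \<Omega>"
    and len: "\<And>is. is \<in> A \<union> B \<Longrightarrow> length is \<le> k"
    and g: "\<And>is. is \<in> A \<union> B \<Longrightarrow> is_weak_deriv \<Omega> is u (g is)"
    and W: "W \<in> borel_measurable (lebesgue_on \<Omega>)" "\<And>x. x \<in> \<Omega> \<Longrightarrow> 0 \<le> W x" "\<And>x. x \<in> \<Omega> \<Longrightarrow> W x \<le> M"
    and C: "0 \<le> C" "0 \<le> M"
    and test: "\<And>\<phi>. \<phi> \<in> test_functions \<Omega> \<Longrightarrow>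
      (\<integral>\<^sup>+x. ennreal (W x * (\<Sum>is\<in>A. (pderivs is \<phi> x)\<^sup>2)) \<partial>lebesgue_on \<Omega>)
      \<le> ennreal C * (\<integral>\<^sup>+x. ennreal ((\<Sum>is\<in>B. pderivs is \<phi> x)\<^sup>2) \<partial>lebesgue_on \<Omega>)"
  shows "(\<integral>\<^sup>+x. ennreal (W x * (\<Sum>is\<in>A. (g is x)\<^sup>2)) \<partial>lebesgue_on \<Omega>)
      \<le> ennreal (4 * C) * (\<integral>\<^sup>+x. ennreal ((\<Sum>is\<in>B. g is x)\<^sup>2) \<partial>lebesgue_on \<Omega>)" (is "?L \<le> _ * ?R")
proof (rule ennreal_le_epsilon)
  fix e :: real assume "0 < e"
  define b where "b = real (card B)"
  define Q where "Q = 4 * C * b * b + 2 * M * real (card A)"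
  have b: "0 \<le> b" by (simp add: b_def)
  have Q: "0 \<le> Q" using C b by (simp add: Q_def)
  define \<delta> where "\<delta> = e / (Q + 1)"
  have \<delta>: "0 < \<delta>" using Q \<open>0 < e\<close> by (simp add: \<delta>_def)
  have Q\<delta>: "Q * \<delta> \<le> e" using Q \<open>0 < e\<close> by (simp add: \<delta>_def field_simps)
  have us: "u \<in> sobolev2 k \<Omega>" using u by (simp add: sobolev2_0_def)
  obtain \<phi> where \<phi>: "\<phi> \<in> test_functions \<Omega>"
    and app: "\<And>is g. length is \<le> k \<Longrightarrow> is_weak_deriv \<Omega> is u g \<Longrightarrow>
      (\<integral>\<^sup>+x. ennreal ((g x - pderivs is \<phi> x)\<^sup>2) \<partial>lebesgue_on \<Omega>) \<le> ennreal \<delta>"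
    using sobolev2_0_approximation[OF \<Omega> u \<delta>] by metis
  have mg: "g is \<in> borel_measurable (lebesgue_on \<Omega>)" if "is \<in> A \<union> B" for "is"
    using weak_deriv_measurable[OF \<Omega> us len g] that by blast
  have mp: "pderivs is \<phi> \<in> borel_measurable (lebesgue_on \<Omega>)" for "is"
    using test_functions_L2[OF \<Omega> test_functions_pderivs[OF \<phi>]] by (auto simp: L2_def)
  let ?D = "\<lambda>is. \<integral>\<^sup>+x. ennreal ((g is x - pderivs is \<phi> x)\<^sup>2) \<partial>lebesgue_on \<Omega>"
  have sumD: "(\<Sum>is\<in>S. ?D is) \<le> ennreal (real (card S) * \<delta>)" if "S \<subseteq> A \<union> B" for S
  proof -
    have "(\<Sum>is\<in>S. ?D is) \<le> (\<Sum>is\<in>S. ennreal \<delta>)"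
      using app[OF len g] that by (intro sum_mono) blast
    also have "\<dots> = ennreal (real (card S) * \<delta>)"
      using \<delta> by (simp add: ennreal_mult ennreal_of_nat_eq_real_of_nat)
    finally show ?thesis .
  qed
  let ?P = "\<integral>\<^sup>+x. ennreal (W x * (\<Sum>is\<in>A. (pderivs is \<phi> x)\<^sup>2)) \<partial>lebesgue_on \<Omega>"
  let ?T = "\<integral>\<^sup>+x. ennreal ((\<Sum>is\<in>B. pderivs is \<phi> x)\<^sup>2) \<partial>lebesgue_on \<Omega>"
  have 1: "?L \<le> ennreal 2 * ?P + ennreal (2 * M) * (\<Sum>is\<in>A. ?D is)"
  proof -
    have "?L \<le> (\<integral>\<^sup>+x. ennreal 2 * ennreal (W x * (\<Sum>is\<in>A. (pderivs is \<phi> x)\<^sup>2))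
        + ennreal (2 * M) * (\<Sum>is\<in>A. ennreal ((g is x - pderivs is \<phi> x)\<^sup>2)) \<partial>lebesgue_on \<Omega>)"
    proof (rule nn_integral_mono)
      fix x assume "x \<in> space (lebesgue_on \<Omega>)"
      then have x: "x \<in> \<Omega>" by simp
      have sq: "(g is x)\<^sup>2 \<le> 2 * (pderivs is \<phi> x)\<^sup>2 + 2 * (g is x - pderivs is \<phi> x)\<^sup>2" for "is"
        using zero_le_power2[of "g is x - 2 * pderivs is \<phi> x"] by (simp add: power2_eq_square algebra_simps)
      have "W x * (\<Sum>is\<in>A. (g is x)\<^sup>2)
        \<le> W x * (\<Sum>is\<in>A. 2 * (pderivs is \<phi> x)\<^sup>2 + 2 * (g is x - pderivs is \<phi> x)\<^sup>2)"
        using W(2)[OF x] sq by (intro mult_left_mono sum_mono) auto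
      also have "\<dots> = 2 * (W x * (\<Sum>is\<in>A. (pderivs is \<phi> x)\<^sup>2))
          + 2 * (W x * (\<Sum>is\<in>A. (g is x - pderivs is \<phi> x)\<^sup>2))"
        by (simp add: sum.distrib algebra_simps flip: sum_distrib_left)
      also have "\<dots> \<le> 2 * (W x * (\<Sum>is\<in>A. (pderivs is \<phi> x)\<^sup>2))
          + 2 * (M * (\<Sum>is\<in>A. (g is x - pderivs is \<phi> x)\<^sup>2))"
        using W(3)[OF x] by (intro add_mono mult_left_mono mult_right_mono sum_nonneg) auto
      finally have le: "W x * (\<Sum>is\<in>A. (g is x)\<^sup>2) \<le> 2 * (W x * (\<Sum>is\<in>A. (pderivs is \<phi> x)\<^sup>2))
          + 2 * M * (\<Sum>is\<in>A. (g is x - pderivs is \<phi> x)\<^sup>2)" by (simp add: mult.assoc)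
      have "ennreal 2 * ennreal (W x * (\<Sum>is\<in>A. (pderivs is \<phi> x)\<^sup>2))
        + ennreal (2 * M) * (\<Sum>is\<in>A. ennreal ((g is x - pderivs is \<phi> x)\<^sup>2))
        = ennreal (2 * (W x * (\<Sum>is\<in>A. (pderivs is \<phi> x)\<^sup>2))
          + 2 * M * (\<Sum>is\<in>A. (g is x - pderivs is \<phi> x)\<^sup>2))"
        using W(2)[OF x] C(2)
        by (subst sum_ennreal, simp, intro ennreal_linear_combination) (auto intro!: sum_nonneg mult_nonneg_nonneg)
      with le show "ennreal (W x * (\<Sum>is\<in>A. (g is x)\<^sup>2))
        \<le> ennreal 2 * ennreal (W x * (\<Sum>is\<in>A. (pderivs is \<phi> x)\<^sup>2))
        + ennreal (2 * M) * (\<Sum>is\<in>A. ennreal ((g is x - pderivs is \<phi> x)\<^sup>2))"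
        by (simp only: ennreal_leI)
    qed
    also have "\<dots> = ennreal 2 * ?P + ennreal (2 * M) * (\<Sum>is\<in>A. ?D is)"
    proof -
      have m1: "(\<lambda>x. ennreal (W x * (\<Sum>is\<in>A. (pderivs is \<phi> x)\<^sup>2))) \<in> borel_measurable (lebesgue_on \<Omega>)"
        using W(1) mp by simp
      have m2: "(\<lambda>x. ennreal ((g is x - pderivs is \<phi> x)\<^sup>2)) \<in> borel_measurable (lebesgue_on \<Omega>)" if "is \<in> A" for "is"
        using mg[of "is"] mp[of "is"] that by simp
      show ?thesis
        using m1 m2 by (subst nn_integral_add, simp, simp) (simp add: nn_integral_cmult nn_integral_sum del: sum_ennreal)
    qed
    finally show ?thesis .
  qed
  have 2: "?T \<le> ennreal 2 * ?R + ennreal (2 * b) * (\<Sum>is\<in>B. ?D is)"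
  proof -
    have "?T \<le> (\<integral>\<^sup>+x. ennreal 2 * ennreal ((\<Sum>is\<in>B. g is x)\<^sup>2)
        + ennreal (2 * b) * (\<Sum>is\<in>B. ennreal ((g is x - pderivs is \<phi> x)\<^sup>2)) \<partial>lebesgue_on \<Omega>)"
    proof (rule nn_integral_mono)
      fix x
      let ?s = "\<Sum>is\<in>B. g is x" and ?t = "\<Sum>is\<in>B. pderivs is \<phi> x"
      have "?t\<^sup>2 \<le> 2 * ?s\<^sup>2 + 2 * (?s - ?t)\<^sup>2"
        using zero_le_power2[of "?t - 2 * ?s"] by (simp add: power2_eq_square algebra_simps)
      also have "(?s - ?t)\<^sup>2 = (\<Sum>is\<in>B. g is x - pderivs is \<phi> x)\<^sup>2" by (simp add: sum_subtractf)
      also have "\<dots> \<le> (\<Sum>is\<in>B. (g is x - pderivs is \<phi> x)\<^sup>2) * b"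
        unfolding b_def by (rule sum_squared_le_sum_of_squares)
      finally have le: "?t\<^sup>2 \<le> 2 * ?s\<^sup>2 + 2 * b * (\<Sum>is\<in>B. (g is x - pderivs is \<phi> x)\<^sup>2)" by (simp add: algebra_simps)
      have "ennreal 2 * ennreal (?s\<^sup>2) + ennreal (2 * b) * (\<Sum>is\<in>B. ennreal ((g is x - pderivs is \<phi> x)\<^sup>2))
        = ennreal (2 * ?s\<^sup>2 + 2 * b * (\<Sum>is\<in>B. (g is x - pderivs is \<phi> x)\<^sup>2))"
        using b
        by (subst sum_ennreal, simp, intro ennreal_linear_combination) (auto intro!: sum_nonneg mult_nonneg_nonneg)
      with le show "ennreal (?t\<^sup>2) \<le> ennreal 2 * ennreal (?s\<^sup>2)
         + ennreal (2 * b) * (\<Sum>is\<in>B. ennreal ((g is x - pderivs is \<phi> x)\<^sup>2))"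
        by (simp only: ennreal_leI)
    qed
    also have "\<dots> = ennreal 2 * ?R + ennreal (2 * b) * (\<Sum>is\<in>B. ?D is)"
    proof -
      have m1: "(\<lambda>x. ennreal ((\<Sum>is\<in>B. g is x)\<^sup>2)) \<in> borel_measurable (lebesgue_on \<Omega>)"
        using mg by simp
      have m2: "(\<lambda>x. ennreal ((g is x - pderivs is \<phi> x)\<^sup>2)) \<in> borel_measurable (lebesgue_on \<Omega>)" if "is \<in> B" for "is"
        using mg[of "is"] mp[of "is"] that by simp
      show ?thesis
        using m1 m2 by (subst nn_integral_add, simp, simp) (simp add: nn_integral_cmult nn_integral_sum del: sum_ennreal)
    qed
    finally show ?thesis .
  qed
  have "?L \<le> ennreal 2 * (ennreal C * ?T) + ennreal (2 * M) * (\<Sum>is\<in>A. ?D is)"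
    using 1 test[OF \<phi>] by (meson add_right_mono mult_left_mono order_trans zero_le)
  also have "\<dots> \<le> ennreal 2 * (ennreal C * (ennreal 2 * ?R + ennreal (2 * b) * ennreal (b * \<delta>)))
      + ennreal (2 * M) * ennreal (real (card A) * \<delta>)"
    using sumD[of A] sumD[of B, folded b_def]
    by (intro add_mono mult_left_mono order_trans[OF 2] order_refl) auto
  also have "\<dots> = ennreal (4 * C) * ?R + ennreal (Q * \<delta>)"
  proof -
    have r: "ennreal 2 * (ennreal C * (ennreal (2 * b) * ennreal (b * \<delta>))) = ennreal (4 * C * b * b * \<delta>)"
    proof -
      have "ennreal t * (ennreal C * (ennreal y * ennreal z)) = ennreal (t * (C * (y * z)))"
        if "0 \<le> t" "0 \<le> y" "0 \<le> z" for t y z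
        using that C by (simp add: ennreal_mult)
      from this[of 2 "2 * b" "b * \<delta>"] show ?thesis
        using b \<delta> by (simp add: algebra_simps)
    qed
    have r2: "ennreal (2 * M) * ennreal (real (card A) * \<delta>) = ennreal (2 * M * real (card A) * \<delta>)"
      using C \<delta> by (simp flip: ennreal_mult)
    have r3: "ennreal 2 * (ennreal C * (ennreal 2 * ?R)) = ennreal (4 * C) * ?R"
    proof -
      have "4 * C = 2 * (C * 2)" by simp
      then have "ennreal (4 * C) = ennreal 2 * (ennreal C * ennreal 2)"
        using C ennreal_mult[of 2 "C * 2"] ennreal_mult[of C 2] by (simp only: mult_nonneg_nonneg zero_le_numeral)
      then show ?thesis by (simp only: mult.assoc)
    qed
    have "ennreal (Q * \<delta>) = ennreal (4 * C * b * b * \<delta>) + ennreal (2 * M * real (card A) * \<delta>)"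
      unfolding Q_def using C b \<delta> by (subst ennreal_plus[symmetric]) (auto simp: algebra_simps)
    then show ?thesis
      by (simp only: distrib_left r r2 r3 add.assoc)
  qed
  also have "\<dots> \<le> ennreal (4 * C) * ?R + ennreal e"
    using Q\<delta> by (intro add_left_mono ennreal_leI)
  finally show "?L \<le> ennreal (4 * C) * ?R + ennreal e" .
qed

section \<open>Rellich inequalities on annuli\<close>

text \<open>
  A test function of the annulus satisfies the assumptions of the punctured plane, and a power of
  |x| / c is a homogeneous weight.
\<close>

lemma annulus_test_function_inequalities:
  assumes \<phi>: "\<phi> \<in> test_functions (annulus a b)" and a: "0 < a" and c: "0 < c" and \<gamma>: "\<gamma> \<noteq> 0"
    and le1: "\<And>x. x \<in> annulus a b \<Longrightarrow> (norm x / c) powr \<gamma> \<le> 1"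
  shows "(\<integral>\<^sup>+x. ennreal ((norm x / c) powr \<gamma> / norm x ^ 4 * (\<phi> x)\<^sup>2) \<partial>lebesgue_on (annulus a b))
      \<le> ennreal (1 / \<gamma>\<^sup>2) * (\<integral>\<^sup>+x. ennreal ((pderivs [1,1] \<phi> x + pderivs [2,2] \<phi> x)\<^sup>2) \<partial>lebesgue_on (annulus a b))"
    "(\<integral>\<^sup>+x. ennreal ((norm x / c) powr \<gamma> / (norm x)\<^sup>2 * ((pderivs [1] \<phi> x)\<^sup>2 + (pderivs [2] \<phi> x)\<^sup>2)) \<partial>lebesgue_on (annulus a b))
      \<le> ennreal ((5/2 + (4 - \<gamma>)\<^sup>2 / 4) / \<gamma>\<^sup>2 + 3/4) * (\<integral>\<^sup>+x. ennreal ((pderivs [1,1] \<phi> x + pderivs [2,2] \<phi> x)\<^sup>2) \<partial>lebesgue_on (annulus a b))"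
proof -
  let ?\<Omega> = "annulus a b"
  have \<Omega>: "open ?\<Omega>" "0 \<notin> ?\<Omega>" using a by (auto simp: annulus_def)
  obtain K where supp: "compact K" "K \<subseteq> ?\<Omega>" "smooth \<phi>" "\<And>is x. x \<notin> K \<Longrightarrow> pderivs is \<phi> x = 0"
    using test_functionsE[OF \<phi>] by blast
  have K0: "0 \<notin> K" using supp(2) \<Omega>(2) by blast
  have sm: "smooth (pderivs is \<phi>)" for "is" by (rule smooth_pderivs[OF supp(3)])
  interpret punctured_plane_C2 K \<phi> "pderivs [1] \<phi>" "pderivs [2] \<phi>" "pderivs [1,1] \<phi>" "pderivs [2,1] \<phi>" "pderivs [2,2] \<phi>"
  proof
    show "continuous_on UNIV \<phi>" by (rule smooth_continuous[OF supp(3)])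
    show "\<phi> x = 0" if "x \<notin> K" for x using supp(4)[OF that, of "[]"] by simp
    show "dir_deriv_on UNIV (axis 1 1) \<phi> (pderivs [1] \<phi>)" "dir_deriv_on UNIV (axis 2 1) \<phi> (pderivs [2] \<phi>)"
      using smooth_dir_deriv[OF supp(3)] by simp_all
    show "dir_deriv_on UNIV (axis 1 1) (pderivs [2] \<phi>) (pderivs [2, 1] \<phi>)"
      using smooth_dir_deriv[OF sm[of "[2]"], of 1] pderiv_dir_commute[OF supp(3), of 1 2] by simp
    show "dir_deriv_on UNIV (axis 1 1) (pderivs [1] \<phi>) (pderivs [1, 1] \<phi>)"
      "dir_deriv_on UNIV (axis 2 1) (pderivs [1] \<phi>) (pderivs [2, 1] \<phi>)"
      "dir_deriv_on UNIV (axis 2 1) (pderivs [2] \<phi>) (pderivs [2, 2] \<phi>)"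
      using smooth_dir_deriv[OF sm[of "[1]"]] smooth_dir_deriv[OF sm[of "[2]"]] by simp_all
  qed (fact supp(1) K0 smooth_continuous[OF sm] supp(4))+
  define E where "E = (\<lambda>x::real^2. (norm x / c) powr \<gamma>)"
  have E_eq: "E x = (sqnorm2 x / c\<^sup>2) powr (\<gamma> / 2)" for x
  proof -
    have "sqnorm2 x / c\<^sup>2 = (norm x / c) powr 2"
      using c by (simp add: sqnorm2_eq_norm power_divide powr_numeral)
    then show ?thesis by (simp add: E_def powr_powr)
  qed
  have E_cont: "continuous_on (-{0}) E"
    unfolding E_def using c by (auto intro!: continuous_intros)
  have E_d: "((\<lambda>t. E (x + t *\<^sub>R axis i 1)) has_real_derivative \<gamma> * E x * x $ i / sqnorm2 x) (at 0)"
    if "x \<noteq> 0" for x i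
  proof -
    have pos: "0 < sqnorm2 x / c\<^sup>2" using sqnorm2_pos[OF that] c by simp
    have "((\<lambda>t. sqnorm2 (x + t *\<^sub>R axis i 1)) has_real_derivative 2 * x $ i) (at 0)"
      unfolding sqnorm2_def using exhaust_2[of i]
      by (auto intro!: derivative_eq_intros simp: axis_def)
    then have "((\<lambda>t. sqnorm2 (x + t *\<^sub>R axis i 1) / c\<^sup>2) has_real_derivative 2 * x $ i / c\<^sup>2) (at 0)"
      by (rule DERIV_cdivide)
    moreover have "((\<lambda>z. z powr (\<gamma> / 2)) has_real_derivative (\<gamma> / 2) * (sqnorm2 x / c\<^sup>2) powr (\<gamma> / 2 - 1))
      (at (sqnorm2 (x + 0 *\<^sub>R axis i 1) / c\<^sup>2))"
      using has_real_derivative_powr[OF pos, of "\<gamma> / 2"] by simp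
    ultimately have "((\<lambda>t. E (x + t *\<^sub>R axis i 1)) has_real_derivative
       (\<gamma> / 2) * (sqnorm2 x / c\<^sup>2) powr (\<gamma> / 2 - 1) * (2 * x $ i / c\<^sup>2)) (at 0)"
      unfolding E_eq by (rule DERIV_chain2[rotated])
    moreover have "(sqnorm2 x / c\<^sup>2) powr (\<gamma> / 2 - 1) = E x / (sqnorm2 x / c\<^sup>2)"
      unfolding E_eq using pos sqnorm2_pos[OF that] by (simp add: powr_diff)
    ultimately show ?thesis using c pos by (simp add: field_simps)
  qed
  have E_deriv: "dir_deriv_on (-{0}) (axis 1 1) E (\<lambda>x. \<gamma> * E x * x$1 / sqnorm2 x)"
      "dir_deriv_on (-{0}) (axis 2 1) E (\<lambda>x. \<gamma> * E x * x$2 / sqnorm2 x)"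
    using E_d by (auto simp: dir_deriv_on_def)
  have E0: "0 \<le> E x" for x by (simp add: E_def)
  have E1: "E x \<le> 1" if "x \<in> K" for x using le1 supp(2) that by (auto simp: E_def)
  note bounds = weighted_bound[OF E_cont E0 E1 E_deriv \<gamma>] weighted_gradient_bound[OF E_cont E0 E1 E_deriv \<gamma>]
  have nn: "(\<integral>\<^sup>+x. ennreal (f x) \<partial>lebesgue_on ?\<Omega>) = ennreal (LINT x|lborel. f x)"
    if f: "continuous_on (-{0}) f" "\<And>x. x \<notin> K \<Longrightarrow> f x = 0" "\<And>x. 0 \<le> f x" for f :: "real ^ 2 \<Rightarrow> real"
  proof -
    have cf: "continuous_on UNIV f"
      by (rule continuous_on_extend_by_zero[OF supp(1) _ _ f(1,2)]) (use K0 in auto)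
    note * = lebesgue_on_lborel_supported[OF cf supp(1,2) \<Omega>(1) f(2)]
    show ?thesis using nn_integral_eq_integral[OF *(1)] f(3) *(2) by simp
  qed
  have pp: "p x = 1 / (norm x)\<^sup>2" for x by (simp add: p_def sqnorm2_eq_norm)
  have R: "(\<integral>\<^sup>+x. ennreal ((pderivs [1,1] \<phi> x + pderivs [2,2] \<phi> x)\<^sup>2) \<partial>lebesgue_on ?\<Omega>)
     = ennreal (LINT x|lborel. (lap x)\<^sup>2)"
    unfolding lap_def[symmetric] using zero' by (intro nn continuous_intros conts) auto
  have L1: "(\<integral>\<^sup>+x. ennreal (E x * (p x)\<^sup>2 * (\<phi> x)\<^sup>2) \<partial>lebesgue_on ?\<Omega>)
     = ennreal (LINT x|lborel. E x * (p x)\<^sup>2 * (\<phi> x)\<^sup>2)"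
    using zero E0 by (intro nn continuous_intros conts E_cont) auto
  have L2: "(\<integral>\<^sup>+x. ennreal (E x * p x * ((pderivs [1] \<phi> x)\<^sup>2 + (pderivs [2] \<phi> x)\<^sup>2)) \<partial>lebesgue_on ?\<Omega>)
     = ennreal (LINT x|lborel. E x * p x * ((pderivs [1] \<phi> x)\<^sup>2 + (pderivs [2] \<phi> x)\<^sup>2))"
    using zero E0 by (intro nn continuous_intros conts E_cont) (auto simp: pp)
  have e1: "(norm x / c) powr \<gamma> / norm x ^ 4 * (\<phi> x)\<^sup>2 = E x * (p x)\<^sup>2 * (\<phi> x)\<^sup>2" for x
    by (simp add: E_def pp power_divide flip: power_mult)
  have e2: "(norm x / c) powr \<gamma> / (norm x)\<^sup>2 * ((pderivs [1] \<phi> x)\<^sup>2 + (pderivs [2] \<phi> x)\<^sup>2)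
     = E x * p x * ((pderivs [1] \<phi> x)\<^sup>2 + (pderivs [2] \<phi> x)\<^sup>2)" for x
    by (simp add: E_def pp)
  show "(\<integral>\<^sup>+x. ennreal ((norm x / c) powr \<gamma> / norm x ^ 4 * (\<phi> x)\<^sup>2) \<partial>lebesgue_on (annulus a b))
      \<le> ennreal (1 / \<gamma>\<^sup>2) * (\<integral>\<^sup>+x. ennreal ((pderivs [1,1] \<phi> x + pderivs [2,2] \<phi> x)\<^sup>2) \<partial>lebesgue_on (annulus a b))"
    unfolding e1 L1 R using bounds(1) by (simp add: ennreal_leI flip: ennreal_mult)
  show "(\<integral>\<^sup>+x. ennreal ((norm x / c) powr \<gamma> / (norm x)\<^sup>2 * ((pderivs [1] \<phi> x)\<^sup>2 + (pderivs [2] \<phi> x)\<^sup>2)) \<partial>lebesgue_on (annulus a b))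
      \<le> ennreal ((5/2 + (4 - \<gamma>)\<^sup>2 / 4) / \<gamma>\<^sup>2 + 3/4) * (\<integral>\<^sup>+x. ennreal ((pderivs [1,1] \<phi> x + pderivs [2,2] \<phi> x)\<^sup>2) \<partial>lebesgue_on (annulus a b))"
    unfolding e2 L2 R using bounds(2) by (subst ennreal_mult[symmetric]) (auto intro!: ennreal_leI)
qed

lemma is_weak_deriv_weak_deriv:
  assumes "u \<in> sobolev2 k \<Omega>" "length is \<le> k"
  shows "is_weak_deriv \<Omega> is u (weak_deriv \<Omega> is u)"
proof -
  obtain g where "is_weak_deriv \<Omega> is u g" using assms by (auto simp: sobolev2_def)
  then show ?thesis unfolding weak_deriv_def by (rule someI[of _ g])
qed

lemma nn_integral_lebesgue_on_add_continuous:
  fixes f g :: "real ^ 'n \<Rightarrow> real"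
  assumes "open \<Omega>" "continuous_on \<Omega> f" "continuous_on \<Omega> g"
    and "\<And>x. 0 \<le> f x" "\<And>x. 0 \<le> g x"
  shows "(\<integral>\<^sup>+x. ennreal (f x + g x) \<partial>lebesgue_on \<Omega>)
    = (\<integral>\<^sup>+x. ennreal (f x) \<partial>lebesgue_on \<Omega>) + (\<integral>\<^sup>+x. ennreal (g x) \<partial>lebesgue_on \<Omega>)"
proof -
  have "f \<in> borel_measurable (lebesgue_on \<Omega>)" "g \<in> borel_measurable (lebesgue_on \<Omega>)"
    using assms by (auto intro: continuous_imp_measurable_on_sets_lebesgue)
  then show ?thesis using assms(4,5) by (simp add: nn_integral_add)
qed

definition gradient_const :: "real \<Rightarrow> real" where
  "gradient_const \<gamma> = (5/2 + (4 - \<gamma>)\<^sup>2 / 4) / \<gamma>\<^sup>2 + 3/4"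

lemma gradient_const_nonneg: "0 \<le> gradient_const \<gamma>"
  by (simp add: gradient_const_def)

text \<open>
  The two weights have exponents \<open>\<gamma>\<close> and \<open>- \<gamma>\<close>: the second one is (|x| / a) to the power - \<gamma>, which
  is at most 1 because |x| > a.
\<close>

lemma annulus_rellich:
  assumes ab: "0 < a" "a < b" and \<gamma>: "0 < \<gamma>" and u: "u \<in> sobolev2_0 2 (annulus a b)"
  shows "(\<integral>\<^sup>+x. ennreal (((norm x / b) powr \<gamma> + (a / norm x) powr \<gamma>) * ((u x)\<^sup>2 / norm x ^ 4))
        \<partial>lebesgue_on (annulus a b))
      \<le> ennreal (8 / \<gamma>\<^sup>2) * (\<integral>\<^sup>+x. ennreal ((weak_laplacian (annulus a b) u x)\<^sup>2) \<partial>lebesgue_on (annulus a b))"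
      (is ?value)
    and "(\<integral>\<^sup>+x. ennreal (((norm x / b) powr \<gamma> + (a / norm x) powr \<gamma>)
          * ((norm (weak_gradient (annulus a b) u x))\<^sup>2 / (norm x)\<^sup>2)) \<partial>lebesgue_on (annulus a b))
      \<le> ennreal (4 * (gradient_const \<gamma> + gradient_const (- \<gamma>)))
        * (\<integral>\<^sup>+x. ennreal ((weak_laplacian (annulus a b) u x)\<^sup>2) \<partial>lebesgue_on (annulus a b))"
      (is ?gradient)
proof -
  define \<Omega> where "\<Omega> = annulus a b"
  have \<Omega>: "open \<Omega>" by (auto simp: \<Omega>_def annulus_def)
  have x\<Omega>: "x \<in> \<Omega> \<longleftrightarrow> a < norm x \<and> norm x < b" for x by (auto simp: \<Omega>_def annulus_def)
  have E: "(norm x / b) powr \<gamma> \<le> 1" "(norm x / a) powr (- \<gamma>) \<le> 1" if "x \<in> \<Omega>" for x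
  proof -
    show "(norm x / b) powr \<gamma> \<le> 1" using that ab \<gamma> by (intro powr_le1) (auto simp: x\<Omega>)
    have "1 \<le> (norm x / a) powr \<gamma>" using that ab \<gamma> by (intro ge_one_powr_ge_zero) (auto simp: x\<Omega>)
    then show "(norm x / a) powr (- \<gamma>) \<le> 1" by (simp add: powr_minus inverse_le_1_iff)
  qed
  define V where "V = (\<lambda>x::real^2. (norm x / b) powr \<gamma> + (norm x / a) powr (- \<gamma>))"
  have V_eq: "V x = (norm x / b) powr \<gamma> + (a / norm x) powr \<gamma>" for x
    using ab by (simp add: V_def powr_minus powr_divide)
  have V: "0 \<le> V x" for x by (simp add: V_def)
  have V2: "V x \<le> 2" if "x \<in> \<Omega>" for x using E[OF that] by (simp add: V_def)
  have cE: "continuous_on \<Omega> (\<lambda>x. (norm x / b) powr \<gamma>)" "continuous_on \<Omega> (\<lambda>x. (norm x / a) powr (- \<gamma>))"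
    using ab by (auto intro!: continuous_intros simp: x\<Omega>)
  have mW: "(\<lambda>x. V x / norm x ^ m) \<in> borel_measurable (lebesgue_on \<Omega>)" for m
  proof -
    have "continuous_on \<Omega> (\<lambda>x. V x / norm x ^ m)"
      unfolding V_def using ab by (intro continuous_intros cE) (auto simp: x\<Omega>)
    then show ?thesis using \<Omega> by (auto intro: continuous_imp_measurable_on_sets_lebesgue)
  qed
  have Wle: "V x / norm x ^ m \<le> 2 / a ^ m" if "x \<in> \<Omega>" for x m
    using V2[OF that] V[of x] that ab by (intro frac_le power_mono) (auto simp: x\<Omega>)
  let ?B = "{[1, 1], [2, 2]} :: 2 list set"
  have us: "u \<in> sobolev2 2 \<Omega>" using u by (simp add: \<Omega>_def sobolev2_0_def)
  have u': "u \<in> sobolev2_0 2 \<Omega>" using u by (simp add: \<Omega>_def)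
  have wd: "is_weak_deriv \<Omega> is u (weak_deriv \<Omega> is u)" if "length is \<le> 2" for "is"
    by (rule is_weak_deriv_weak_deriv[OF us that])
  have wN: "is_weak_deriv \<Omega> [] u u"
    using wd[of "[]"] by (intro is_weak_deriv_Nil) (auto simp: is_weak_deriv_def)
  have lapl: "(\<Sum>is\<in>?B. weak_deriv \<Omega> is u x) = weak_laplacian \<Omega> u x" for x
    by (simp add: weak_laplacian_def sum_2)
  have grad: "(\<Sum>is\<in>{[1], [2]}. (weak_deriv \<Omega> is u x)\<^sup>2) = (norm (weak_gradient \<Omega> u x))\<^sup>2" for x
    by (simp add: weak_gradient_def norm_vec_def L2_set_def sum_2)
  have test: "(\<integral>\<^sup>+x. ennreal (V x / norm x ^ 4 * (\<Sum>is\<in>{[]}. (pderivs is \<phi> x)\<^sup>2)) \<partial>lebesgue_on \<Omega>)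
      \<le> ennreal (2 / \<gamma>\<^sup>2) * (\<integral>\<^sup>+x. ennreal ((\<Sum>is\<in>?B. pderivs is \<phi> x)\<^sup>2) \<partial>lebesgue_on \<Omega>)"
    "(\<integral>\<^sup>+x. ennreal (V x / norm x ^ 2 * (\<Sum>is\<in>{[1], [2]}. (pderivs is \<phi> x)\<^sup>2)) \<partial>lebesgue_on \<Omega>)
      \<le> ennreal (gradient_const \<gamma> + gradient_const (- \<gamma>)) * (\<integral>\<^sup>+x. ennreal ((\<Sum>is\<in>?B. pderivs is \<phi> x)\<^sup>2) \<partial>lebesgue_on \<Omega>)"
    if \<phi>: "\<phi> \<in> test_functions \<Omega>" for \<phi>
  proof -
    let ?R = "\<integral>\<^sup>+x. ennreal ((pderivs [1,1] \<phi> x + pderivs [2,2] \<phi> x)\<^sup>2) \<partial>lebesgue_on \<Omega>"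
    have split: "V x / norm x ^ m * s = (norm x / b) powr \<gamma> / norm x ^ m * s + (norm x / a) powr (- \<gamma>) / norm x ^ m * s"
      for x s m by (simp add: V_def add_divide_distrib distrib_right)
    have grad': "(\<Sum>is\<in>{[1 :: 2], [2]}. (pderivs is \<phi> x)\<^sup>2) = (pderivs [1] \<phi> x)\<^sup>2 + (pderivs [2] \<phi> x)\<^sup>2" for x
      by simp
    have R: "(\<integral>\<^sup>+x. ennreal ((\<Sum>is\<in>?B. pderivs is \<phi> x)\<^sup>2) \<partial>lebesgue_on \<Omega>) = ?R" by simp
    have sm: "smooth (pderivs is \<phi>)" for "is"
      using test_functions_pderivs[OF \<phi>] by (auto simp: test_functions_def)
    have c\<phi>: "continuous_on \<Omega> (pderivs is \<phi>)" for "is" by (rule smooth_continuous[OF sm])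
    note b = annulus_test_function_inequalities[of \<phi> a b b \<gamma>, folded \<Omega>_def, OF \<phi> ab(1) _ _ E(1)]
    note b' = annulus_test_function_inequalities[of \<phi> a b a "- \<gamma>", folded \<Omega>_def, OF \<phi> ab(1) ab(1) _ E(2)]
    have "(\<integral>\<^sup>+x. ennreal (V x / norm x ^ 4 * (\<Sum>is\<in>{[]}. (pderivs is \<phi> x)\<^sup>2)) \<partial>lebesgue_on \<Omega>)
      = (\<integral>\<^sup>+x. ennreal ((norm x / b) powr \<gamma> / norm x ^ 4 * (\<phi> x)\<^sup>2
          + (norm x / a) powr (- \<gamma>) / norm x ^ 4 * (\<phi> x)\<^sup>2) \<partial>lebesgue_on \<Omega>)"
      unfolding split by simp
    also have "\<dots> = (\<integral>\<^sup>+x. ennreal ((norm x / b) powr \<gamma> / norm x ^ 4 * (\<phi> x)\<^sup>2) \<partial>lebesgue_on \<Omega>)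
          + (\<integral>\<^sup>+x. ennreal ((norm x / a) powr (- \<gamma>) / norm x ^ 4 * (\<phi> x)\<^sup>2) \<partial>lebesgue_on \<Omega>)"
      using ab c\<phi>[of "[]"] by (intro nn_integral_lebesgue_on_add_continuous \<Omega> continuous_intros cE) (auto simp: x\<Omega>)
    also have "\<dots> \<le> ennreal (1 / \<gamma>\<^sup>2) * ?R + ennreal (1 / (- \<gamma>)\<^sup>2) * ?R"
      using ab \<gamma> by (intro add_mono b(1) b'(1)) auto
    also have "\<dots> = ennreal (2 / \<gamma>\<^sup>2) * ?R"
      by (simp flip: distrib_right ennreal_plus)
    finally show "(\<integral>\<^sup>+x. ennreal (V x / norm x ^ 4 * (\<Sum>is\<in>{[]}. (pderivs is \<phi> x)\<^sup>2)) \<partial>lebesgue_on \<Omega>)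
      \<le> ennreal (2 / \<gamma>\<^sup>2) * (\<integral>\<^sup>+x. ennreal ((\<Sum>is\<in>?B. pderivs is \<phi> x)\<^sup>2) \<partial>lebesgue_on \<Omega>)"
      unfolding R .
    have "(\<integral>\<^sup>+x. ennreal (V x / norm x ^ 2 * (\<Sum>is\<in>{[1], [2]}. (pderivs is \<phi> x)\<^sup>2)) \<partial>lebesgue_on \<Omega>)
      = (\<integral>\<^sup>+x. ennreal ((norm x / b) powr \<gamma> / (norm x)\<^sup>2 * ((pderivs [1] \<phi> x)\<^sup>2 + (pderivs [2] \<phi> x)\<^sup>2)
          + (norm x / a) powr (- \<gamma>) / (norm x)\<^sup>2 * ((pderivs [1] \<phi> x)\<^sup>2 + (pderivs [2] \<phi> x)\<^sup>2)) \<partial>lebesgue_on \<Omega>)"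
      unfolding split grad' ..
    also have "\<dots> = (\<integral>\<^sup>+x. ennreal ((norm x / b) powr \<gamma> / (norm x)\<^sup>2 * ((pderivs [1] \<phi> x)\<^sup>2 + (pderivs [2] \<phi> x)\<^sup>2)) \<partial>lebesgue_on \<Omega>)
          + (\<integral>\<^sup>+x. ennreal ((norm x / a) powr (- \<gamma>) / (norm x)\<^sup>2 * ((pderivs [1] \<phi> x)\<^sup>2 + (pderivs [2] \<phi> x)\<^sup>2)) \<partial>lebesgue_on \<Omega>)"
      using ab by (intro nn_integral_lebesgue_on_add_continuous \<Omega> continuous_intros cE c\<phi>) (auto simp: x\<Omega>)
    also have "\<dots> \<le> ennreal (gradient_const \<gamma>) * ?R + ennreal (gradient_const (- \<gamma>)) * ?R"
      unfolding gradient_const_def using ab \<gamma> by (intro add_mono b(2) b'(2)) auto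
    also have "\<dots> = ennreal (gradient_const \<gamma> + gradient_const (- \<gamma>)) * ?R"
      using gradient_const_nonneg by (simp flip: distrib_right)
    finally show "(\<integral>\<^sup>+x. ennreal (V x / norm x ^ 2 * (\<Sum>is\<in>{[1], [2]}. (pderivs is \<phi> x)\<^sup>2)) \<partial>lebesgue_on \<Omega>)
      \<le> ennreal (gradient_const \<gamma> + gradient_const (- \<gamma>)) * (\<integral>\<^sup>+x. ennreal ((\<Sum>is\<in>?B. pderivs is \<phi> x)\<^sup>2) \<partial>lebesgue_on \<Omega>)"
      unfolding R .
  qed
  define g where "g = (\<lambda>is. if is = [] then u else weak_deriv \<Omega> is u)"
  have "(\<integral>\<^sup>+x. ennreal (V x / norm x ^ 4 * (\<Sum>is\<in>{[]}. (g is x)\<^sup>2)) \<partial>lebesgue_on \<Omega>)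
    \<le> ennreal (4 * (2 / \<gamma>\<^sup>2)) * (\<integral>\<^sup>+x. ennreal ((\<Sum>is\<in>?B. g is x)\<^sup>2) \<partial>lebesgue_on \<Omega>)"
  proof (rule sobolev2_0_inequality_from_test_functions[OF \<Omega> u' _ _ mW _ Wle _ _ test(1)])
    show "is_weak_deriv \<Omega> is u (g is)" if "is \<in> {[]} \<union> ?B" for "is"
      using that wd wN by (auto simp: g_def)
  qed (use V ab in auto)
  also have "(\<lambda>x. \<Sum>is\<in>?B. g is x) = weak_laplacian \<Omega> u"
    unfolding lapl[symmetric] by (simp add: g_def)
  finally show ?value
    unfolding \<Omega>_def[symmetric] V_eq[symmetric] by (simp add: g_def)
  have "(\<integral>\<^sup>+x. ennreal (V x / norm x ^ 2 * (\<Sum>is\<in>{[1], [2]}. (weak_deriv \<Omega> is u x)\<^sup>2)) \<partial>lebesgue_on \<Omega>)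
    \<le> ennreal (4 * (gradient_const \<gamma> + gradient_const (- \<gamma>)))
      * (\<integral>\<^sup>+x. ennreal ((\<Sum>is\<in>?B. weak_deriv \<Omega> is u x)\<^sup>2) \<partial>lebesgue_on \<Omega>)"
  proof (rule sobolev2_0_inequality_from_test_functions[OF \<Omega> u' _ _ mW _ Wle _ _ test(2)])
    show "is_weak_deriv \<Omega> is u (weak_deriv \<Omega> is u)" if "is \<in> {[1], [2]} \<union> ?B" for "is"
      using that by (intro wd) auto
  qed (use V ab gradient_const_nonneg in auto)
  then show ?gradient
    unfolding \<Omega>_def[symmetric] V_eq[symmetric] lapl grad by simp
qed

theorem theorem4p2:
  shows "(\<forall>\<beta>::real. 1 / 2 < \<beta> \<longrightarrow>
      (\<exists>C::real. \<forall>(a::real) (b::real). 0 < a \<and> a < b \<longrightarrow>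
        (\<forall>u \<in> sobolev2_0 2 (annulus a b).
          (\<integral>\<^sup>+ x. ennreal (((norm x / b) powr (4 * \<beta>) + (a / norm x) powr (4 * \<beta>))
              * ((u x)\<^sup>2 / norm x ^ 4)) \<partial>lebesgue_on (annulus a b))
          \<le> ennreal C * (\<integral>\<^sup>+ x. ennreal ((weak_laplacian (annulus a b) u x)\<^sup>2)
              \<partial>lebesgue_on (annulus a b)))))
    \<and>
    (\<forall>\<beta>::real. sqrt 2 - 1 < \<beta> \<longrightarrow>
      (\<exists>C'::real. \<forall>(a::real) (b::real). 0 < a \<and> a < b \<longrightarrow>
        (\<forall>u \<in> sobolev2_0 2 (annulus a b).
          (\<integral>\<^sup>+ x. ennreal (((norm x / b) powr (2 * \<beta>) + (a / norm x) powr (2 * \<beta>))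
              * ((norm (weak_gradient (annulus a b) u x))\<^sup>2 / (norm x)\<^sup>2)) \<partial>lebesgue_on (annulus a b))
          \<le> ennreal C' * (\<integral>\<^sup>+ x. ennreal ((weak_laplacian (annulus a b) u x)\<^sup>2)
              \<partial>lebesgue_on (annulus a b)))))"
proof (intro conjI allI impI)
  fix \<beta> :: real assume "1 / 2 < \<beta>"
  then have "0 < 4 * \<beta>" by simp
  then show "\<exists>C::real. \<forall>a b. 0 < a \<and> a < b \<longrightarrow>
        (\<forall>u \<in> sobolev2_0 2 (annulus a b).
          (\<integral>\<^sup>+ x. ennreal (((norm x / b) powr (4 * \<beta>) + (a / norm x) powr (4 * \<beta>))
              * ((u x)\<^sup>2 / norm x ^ 4)) \<partial>lebesgue_on (annulus a b))
          \<le> ennreal C * (\<integral>\<^sup>+ x. ennreal ((weak_laplacian (annulus a b) u x)\<^sup>2)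
              \<partial>lebesgue_on (annulus a b)))"
    by (intro exI[of _ "8 / (4 * \<beta>)\<^sup>2"] allI impI ballI annulus_rellich(1)) auto
next
  fix \<beta> :: real assume "sqrt 2 - 1 < \<beta>"
  moreover have "1 \<le> sqrt 2" by simp
  ultimately have "0 < 2 * \<beta>" by linarith
  then show "\<exists>C'::real. \<forall>a b. 0 < a \<and> a < b \<longrightarrow>
        (\<forall>u \<in> sobolev2_0 2 (annulus a b).
          (\<integral>\<^sup>+ x. ennreal (((norm x / b) powr (2 * \<beta>) + (a / norm x) powr (2 * \<beta>))
              * ((norm (weak_gradient (annulus a b) u x))\<^sup>2 / (norm x)\<^sup>2)) \<partial>lebesgue_on (annulus a b))
          \<le> ennreal C' * (\<integral>\<^sup>+ x. ennreal ((weak_laplacian (annulus a b) u x)\<^sup>2)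
              \<partial>lebesgue_on (annulus a b)))"
    by (intro exI[of _ "4 * (gradient_const (2 * \<beta>) + gradient_const (- (2 * \<beta>)))"] allI impI ballI
      annulus_rellich(2)) auto
qed

end
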